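(* Let $K$ be an imaginary quadratic number field with ring of integers $\mathcal{O}_K$. There is no Diophantine $m$-tuple in $\mathcal{O}_K$ (consisting of nonzero elements) with $m\geqslant 43$.
   Context: A Diophantine $m$-tuple in $\mathcal{O}_K$ is a set of $m$ distinct elements of $\mathcal{O}_K$ such that the product of any two distinct elements plus one is a perfect square in $\mathcal{O}_K$. The paper makes the standing assumption that $0$ is not an element of any Diophantine $m$-tuple considered. *)

theory Defs
  imports Complex_Main "HOL-Computational_Algebra.Polynomial"
begin

definition complex_subfield :: "complex set \<Rightarrow> bool" where
  "complex_subfield K \<longleftrightarrow> 0 \<in> K \<and> 1 \<in> K \<and>
     (\<forall>x\<in>K. \<forall>y\<in>K. x + y \<in> K \<and> x * y \<in> K) \<and>
     (\<forall>x\<in>K. - x \<in> K \<and> inverse x \<in> K)"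

definition rat_scale :: "rat \<Rightarrow> complex \<Rightarrow> complex" where
  "rat_scale q z = of_rat q * z"

lemma vector_space_rat_scale: "vector_space rat_scale"
  by unfold_locales (simp_all add: rat_scale_def algebra_simps of_rat_add of_rat_mult)

(* A subfield contains the rationals, so it is its own rational span and the dimension
   below is its degree over the rationals. The library function vector_space.dim returns 0
   in the infinite-dimensional case, hence the value 2 also asserts finiteness. *)
definition degree_over_rat :: "complex set \<Rightarrow> nat" where
  "degree_over_rat K = vector_space.dim rat_scale K"

(* Number fields are taken as subfields of the complex numbers; every number field is
   isomorphic to one. A quadratic field is Galois over the rationals, so all its embeddings
   have the same image and "imaginary" means that this image is not contained in the reals. *)
definition imaginary_quadratic_field :: "complex set \<Rightarrow> bool" where
  "imaginary_quadratic_field K \<longleftrightarrow>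
     complex_subfield K \<and> degree_over_rat K = 2 \<and> \<not> K \<subseteq> \<real>"

definition ring_of_integers :: "complex set \<Rightarrow> complex set" where
  "ring_of_integers K = {x \<in> K. algebraic_int x}"

definition diophantine_tuple :: "'a::comm_ring_1 set \<Rightarrow> nat \<Rightarrow> 'a set \<Rightarrow> bool" where
  "diophantine_tuple R m A \<longleftrightarrow>
     A \<subseteq> R \<and> finite A \<and> card A = m \<and>
     (\<forall>a\<in>A. \<forall>b\<in>A. a \<noteq> b \<longrightarrow> (\<exists>c\<in>R. a * b + 1 = c\<^sup>2))"

end

theory Submission
  imports Defs "HOL-Analysis.Generalised_Binomial_Theorem" "HOL-Number_Theory.Cong"
begin

text \<open>Elements of absolute value at least 3 grow fast: if \<open>c\<close> is the largest element of a triple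
  \<open>{a, b, c}\<close> with \<open>c \<noteq> a + b \<plusminus> 2 * r\<close>, where \<open>r\<^sup>2 = a * b + 1\<close>, then \<open>\<bar>c\<bar> \<ge> 2 * \<bar>a\<bar> * \<bar>b\<bar>\<close>, and for given two
  elements the excluded case occurs for at most one smaller third element. So in a set of 21 such elements
  there are \<open>a, b, c, d\<close> with \<open>c\<close> larger than a high power of \<open>b\<close> and \<open>d\<close> larger than a high power of \<open>c\<close>.
  The square roots of \<open>a * d + 1\<close>, \<open>b * d + 1\<close>, \<open>c * d + 1\<close> then provide simultaneous approximations to
  \<open>sqrt (1 + a / N)\<close> and \<open>sqrt (1 + b / N)\<close>, \<open>N = a * b * c\<close>, with a common denominator, that are better than
  Rickert's hypergeometric method allows. That method is carried out by Hermite interpolation of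
  \<open>(1 + z / N) powr (k + 1 / 2)\<close> at the nodes \<open>0\<close>, \<open>a\<close>, \<open>b\<close>: replacing the values by the approximations gives a
  polynomial of degree at least \<open>3 * k\<close> with integral coefficients, whereas its top coefficients are small
  because the binomial series converges quickly. The elements of absolute value below 3 are counted directly.\<close>

subsection \<open>Weighted norms of polynomials\<close>

text \<open>The obstacle in such an argument is to know that the integer compared with 1 is nonzero.
  A common way is to prove that a determinant of several approximants does not vanish. Here one
  nonzero coefficient of index at least \<open>3 * k\<close> suffices, and it exists because a
  half-integral exponent is never the degree of a polynomial. That nonzero integers have absolute
  value at least 1 is the arithmetic input of both the approximation and the gap argument; it holds
  because the squared absolute value of an imaginary quadratic integer is a rational integer. The
  order \<open>k\<close> has to be balanced. Up to constants, raising it by one multiplies the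
  contribution of the series tail by \<open>r ^ 6 / |N| ^ 2\<close> and that of the approximation
  errors by \<open>r ^ 3 * |N|\<close>. The tail shrinks fast enough only if \<open>N\<close>
  exceeds a high power of \<open>r = |b|\<close>, so \<open>c\<close> must outgrow \<open>b\<close>.
  With \<open>k\<close> as small as the tail permits, the root of \<open>c * d + 1\<close> is
  bounded by fixed powers of \<open>b\<close> and \<open>c\<close>, which \<open>d\<close> must
  outgrow. In a list sorted by absolute value, the indices 0, 1, 12, 20 for \<open>a\<close>,
  \<open>b\<close>, \<open>c\<close>, \<open>d\<close> leave enough room for both.\<close>

definition wnorm :: "real \<Rightarrow> complex poly \<Rightarrow> real" where
  "wnorm r p = poly (map_poly norm p) r"

lemma wnorm_0 [simp]: "wnorm r 0 = 0"
  by (simp add: wnorm_def)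

lemma wnorm_pCons [simp]: "wnorm r (pCons a p) = norm a + r * wnorm r p"
  by (cases "a = 0 \<and> p = 0") (auto simp: wnorm_def map_poly_pCons)

lemma wnorm_1 [simp]: "wnorm r 1 = 1"
  by (simp add: one_pCons)

lemma wnorm_nonneg [simp]: "r \<ge> 0 \<Longrightarrow> wnorm r p \<ge> 0"
  by (induction p) auto

lemma wnorm_add: "r \<ge> 0 \<Longrightarrow> wnorm r (p + q) \<le> wnorm r p + wnorm r q"
proof (induction p q rule: poly_induct2)
  case (pCons a p b q)
  have "r * wnorm r (p + q) \<le> r * (wnorm r p + wnorm r q)"
    using pCons by (intro mult_left_mono) auto
  then show ?case using norm_triangle_ineq[of a b] by (simp add: algebra_simps)
qed simp

lemma wnorm_smult: "wnorm r (smult c p) = norm c * wnorm r p"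
  by (induction p) (auto simp: norm_mult algebra_simps)

lemma wnorm_mult: "r \<ge> 0 \<Longrightarrow> wnorm r (p * q) \<le> wnorm r p * wnorm r q"
proof (induction p)
  case (pCons a p)
  have "wnorm r (pCons a p * q) \<le> wnorm r (smult a q) + wnorm r (pCons 0 (p * q))"
    unfolding mult_pCons_left by (rule wnorm_add) fact
  also have "\<dots> \<le> norm a * wnorm r q + r * (wnorm r p * wnorm r q)"
    using pCons by (simp add: wnorm_smult mult_left_mono)
  finally show ?case by (simp add: algebra_simps)
qed simp

lemma wnorm_prod: "r \<ge> 0 \<Longrightarrow> wnorm r (prod f A) \<le> (\<Prod>i\<in>A. wnorm r (f i))"
proof (induction A rule: infinite_finite_induct)
  case (insert x A)
  have "wnorm r (prod f (insert x A)) \<le> wnorm r (f x) * wnorm r (prod f A)"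
    using insert by (simp add: wnorm_mult)
  also have "\<dots> \<le> wnorm r (f x) * (\<Prod>i\<in>A. wnorm r (f i))"
    using insert by (intro mult_left_mono) auto
  finally show ?case using insert by simp
qed simp_all

lemma wnorm_power: "r \<ge> 0 \<Longrightarrow> wnorm r (p ^ n) \<le> wnorm r p ^ n"
  using wnorm_prod[of r "\<lambda>_. p" "{..<n}"] by simp

lemma wnorm_sum: "r \<ge> 0 \<Longrightarrow> wnorm r (sum f A) \<le> (\<Sum>i\<in>A. wnorm r (f i))"
proof (induction A rule: infinite_finite_induct)
  case (insert x A)
  then show ?case using wnorm_add[of r "f x" "sum f A"] by simp
qed simp_all

lemma wnorm_monom: "wnorm r (monom c n) = norm c * r ^ n"
  by (induction n) (auto simp: monom_0 monom_Suc)

text \<open>Used for the shift by a node \<open>s\<close> with \<open>norm s \<le> r\<close>: the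
  radius grows from \<open>r\<close> to at most \<open>2 * r\<close>.\<close>

lemma wnorm_pcompose: "r \<ge> 0 \<Longrightarrow> wnorm r (pcompose p q) \<le> wnorm (wnorm r q) p"
proof (induction p)
  case (pCons a p)
  have "wnorm r (pcompose (pCons a p) q) \<le> wnorm r [:a:] + wnorm r (q * pcompose p q)"
    unfolding pcompose_pCons by (rule wnorm_add) fact
  also have "wnorm r (q * pcompose p q) \<le> wnorm r q * wnorm r (pcompose p q)"
    using pCons by (intro wnorm_mult)
  also have "\<dots> \<le> wnorm r q * wnorm (wnorm r q) p"
    using pCons by (intro mult_left_mono) auto
  finally show ?case by simp
qed simp

lemma poly_cutoff_Suc_pCons: "poly_cutoff (Suc n) (pCons a p) = pCons a (poly_cutoff n p)"
  by (rule poly_eqI) (auto simp: coeff_poly_cutoff coeff_pCons split: nat.split)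

lemma wnorm_cutoff: "r \<ge> 0 \<Longrightarrow> wnorm r (poly_cutoff n p) \<le> wnorm r p"
proof (induction p arbitrary: n)
  case (pCons a p)
  show ?case
  proof (cases n)
    case 0
    then have "poly_cutoff n (pCons a p) = 0" by (simp add: poly_eq_iff coeff_poly_cutoff)
    then show ?thesis using pCons.prems wnorm_nonneg[of r "pCons a p"] by simp
  next
    case (Suc m)
    then show ?thesis using pCons by (simp add: poly_cutoff_Suc_pCons mult_left_mono)
  qed
qed simp

lemma wnorm_mono: "0 \<le> r \<Longrightarrow> r \<le> s \<Longrightarrow> wnorm r p \<le> wnorm s p"
  by (induction p) (auto intro!: mult_mono)

text \<open>The norm is an upper bound for a single weighted coefficient. At an index of at least
  \<open>3 * k\<close> the weight is at least \<open>r ^ (3 * k)\<close>, which later cancels a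
  large factor.\<close>

lemma coeff_le_wnorm: "r \<ge> 0 \<Longrightarrow> norm (coeff p i) * r ^ i \<le> wnorm r p"
proof (induction p arbitrary: i)
  case (pCons a p)
  show ?case
  proof (cases i)
    case 0
    then show ?thesis using pCons.prems by simp
  next
    case (Suc j)
    have "norm (coeff (pCons a p) i) * r ^ i = r * (norm (coeff p j) * r ^ j)"
      by (simp add: Suc algebra_simps)
    also have "\<dots> \<le> r * wnorm r p" using pCons by (intro mult_left_mono)
    finally show ?thesis by (simp add: add_increasing)
  qed
qed simp

lemma wnorm_le_sum:
  assumes "r \<ge> 0" "\<And>i. i > n \<Longrightarrow> coeff p i = 0"
  shows "wnorm r p \<le> (\<Sum>i\<le>n. norm (coeff p i) * r ^ i)"
proof -
  have "p = (\<Sum>i\<le>n. monom (coeff p i) i)"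
    by (rule poly_eqI) (auto simp: coeff_sum assms)
  then have "wnorm r p = wnorm r (\<Sum>i\<le>n. monom (coeff p i) i)" by simp
  also have "\<dots> \<le> (\<Sum>i\<le>n. wnorm r (monom (coeff p i) i))" by (intro wnorm_sum assms)
  finally show ?thesis by (simp add: wnorm_monom)
qed

subsection \<open>Discrete subrings of the complex numbers\<close>

text \<open>The approximation and gap arguments see the ring of integers only through these
  properties; \<open>norm_ge_1\<close> is what separates imaginary quadratic rings from general
  rings of integers.\<close>

locale discrete_ring =
  fixes R :: "complex set"
  assumes one_mem: "1 \<in> R"
    and diff_mem: "x \<in> R \<Longrightarrow> y \<in> R \<Longrightarrow> x - y \<in> R"
    and mult_mem: "x \<in> R \<Longrightarrow> y \<in> R \<Longrightarrow> x * y \<in> R"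
    and norm_ge_1: "x \<in> R \<Longrightarrow> x \<noteq> 0 \<Longrightarrow> norm x \<ge> 1"
begin

lemma zero_mem: "0 \<in> R"
  using diff_mem[OF one_mem one_mem] by simp

lemma uminus_mem: "x \<in> R \<Longrightarrow> - x \<in> R"
  using diff_mem[OF zero_mem] by simp

lemma add_mem: "x \<in> R \<Longrightarrow> y \<in> R \<Longrightarrow> x + y \<in> R"
  using diff_mem[of x "- y"] uminus_mem by simp

lemma power_mem: "x \<in> R \<Longrightarrow> x ^ n \<in> R"
  by (induction n) (auto intro: one_mem mult_mem)

lemma sum_mem: "(\<And>i. i \<in> A \<Longrightarrow> f i \<in> R) \<Longrightarrow> sum f A \<in> R"
  by (induction A rule: infinite_finite_induct) (auto intro: zero_mem add_mem)

lemma of_nat_mem: "of_nat n \<in> R"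
  by (induction n) (auto intro: zero_mem one_mem add_mem)

lemma numeral_mem: "numeral n \<in> R"
  using of_nat_mem[of "numeral n"] by simp

lemma of_int_mem: "of_int n \<in> R"
  by (cases n) (auto intro: of_nat_mem uminus_mem simp del: of_nat_Suc)

definition polys :: "complex poly set" where
  "polys = {p. \<forall>i. coeff p i \<in> R}"

lemma polysI: "(\<And>i. coeff p i \<in> R) \<Longrightarrow> p \<in> polys"
  and polysD: "p \<in> polys \<Longrightarrow> coeff p i \<in> R"
  by (auto simp: polys_def)

lemma zero_polys: "0 \<in> polys"
  by (rule polysI) (simp add: zero_mem)

lemma one_polys: "1 \<in> polys"
  by (auto intro!: polysI simp: zero_mem one_mem coeff_1)

lemma pCons_polys: "a \<in> R \<Longrightarrow> p \<in> polys \<Longrightarrow> pCons a p \<in> polys"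
  by (auto intro!: polysI simp: coeff_pCons polysD split: nat.split)

lemma add_polys: "p \<in> polys \<Longrightarrow> q \<in> polys \<Longrightarrow> p + q \<in> polys"
  by (auto intro!: polysI add_mem dest: polysD)

lemma smult_polys: "c \<in> R \<Longrightarrow> p \<in> polys \<Longrightarrow> smult c p \<in> polys"
  by (auto intro!: polysI mult_mem dest: polysD)

lemma mult_polys: "p \<in> polys \<Longrightarrow> q \<in> polys \<Longrightarrow> p * q \<in> polys"
  by (rule polysI) (auto simp: coeff_mult intro!: sum_mem mult_mem dest: polysD)

lemma sum_polys: "(\<And>i. i \<in> A \<Longrightarrow> f i \<in> polys) \<Longrightarrow> sum f A \<in> polys"
  by (induction A rule: infinite_finite_induct) (auto intro: zero_polys add_polys)

lemma prod_polys: "(\<And>i. i \<in> A \<Longrightarrow> f i \<in> polys) \<Longrightarrow> prod f A \<in> polys"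
  by (induction A rule: infinite_finite_induct) (auto intro: one_polys mult_polys)

lemma power_polys: "p \<in> polys \<Longrightarrow> p ^ n \<in> polys"
  by (induction n) (auto intro: one_polys mult_polys)

lemma monom_polys: "c \<in> R \<Longrightarrow> monom c n \<in> polys"
  by (auto intro!: polysI simp: zero_mem)

lemma cutoff_polys: "p \<in> polys \<Longrightarrow> poly_cutoff n p \<in> polys"
  by (auto intro!: polysI simp: coeff_poly_cutoff zero_mem polysD)

lemma pcompose_polys: "p \<in> polys \<Longrightarrow> q \<in> polys \<Longrightarrow> pcompose p q \<in> polys"
proof (induction p)
  case (pCons a p)
  have "a \<in> R" "p \<in> polys"
    using polysD[OF pCons.prems(1), of 0] polysD[OF pCons.prems(1), of "Suc _"]
    by (auto intro: polysI)
  then show ?case using pCons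
    by (auto simp: pcompose_pCons intro!: add_polys mult_polys pCons_polys zero_polys)
qed (simp add: zero_polys)

end

subsection \<open>Truncated negative powers\<close>

text \<open>\<open>neg_power k k \<delta>\<close> is \<open>\<delta> ^ (2 * k + 1)\<close> times the expansion of \<open>(\<delta> + w) powi - (k + 1)\<close>
  modulo \<open>w ^ (k + 1)\<close>.\<close>

definition neg_power :: "nat \<Rightarrow> nat \<Rightarrow> complex \<Rightarrow> complex poly" where
  "neg_power j k d = (\<Sum>m\<le>k. monom (of_nat ((j + m) choose m) * (-1) ^ m * d ^ (k - m)) m)"

lemma coeff_neg_power:
  "coeff (neg_power j k d) m = (if m \<le> k then of_nat ((j + m) choose m) * (-1) ^ m * d ^ (k - m) else 0)"
  by (simp add: neg_power_def coeff_sum)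

lemma cong_monom_iff:
  "[p = q] (mod monom 1 n) \<longleftrightarrow> (\<forall>i<n. coeff p i = coeff (q :: complex poly) i)"
  by (simp add: cong_iff_dvd_diff monom_1_dvd_iff')

text \<open>Pascal's rule for the coefficients. The first index varies so that the power of
  \<open>[:d, 1:]\<close> can be raised one at a time, while the truncation order \<open>k\<close>
  stays fixed.\<close>

lemma neg_power_step: "[[:d, 1:] * neg_power (Suc j) k d = smult d (neg_power j k d)] (mod monom 1 (Suc k))"
  unfolding cong_monom_iff
proof (intro allI impI)
  fix i assume i: "i < Suc k"
  show "coeff ([:d, 1:] * neg_power (Suc j) k d) i = coeff (smult d (neg_power j k d)) i"
  proof (cases i)
    case 0
    then show ?thesis by (simp add: coeff_neg_power)
  next
    case (Suc m)
    then have "k - m = Suc (k - Suc m)" using i by simp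
    then show ?thesis using i by (simp add: coeff_neg_power Suc algebra_simps)
  qed
qed

lemma neg_power_base: "[[:d, 1:] * neg_power 0 k d = [:d ^ Suc k:]] (mod monom 1 (Suc k))"
  unfolding cong_monom_iff
proof (intro allI impI)
  fix i assume i: "i < Suc k"
  show "coeff ([:d, 1:] * neg_power 0 k d) i = coeff [:d ^ Suc k:] i"
  proof (cases i)
    case 0
    then show ?thesis by (simp add: coeff_neg_power)
  next
    case (Suc m)
    then have "k - m = Suc (k - Suc m)" using i by simp
    then show ?thesis using i by (simp add: coeff_neg_power Suc algebra_simps)
  qed
qed

lemma neg_power_cong:
  "[[:d, 1:] ^ Suc j * neg_power j k d = [:d ^ (Suc k + j):]] (mod monom 1 (Suc k))"
proof (induction j)
  case 0
  then show ?case using neg_power_base by simp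
next
  case (Suc j)
  have "[[:d, 1:] ^ Suc j * ([:d, 1:] * neg_power (Suc j) k d) = [:d, 1:] ^ Suc j * smult d (neg_power j k d)] (mod monom 1 (Suc k))"
    by (intro cong_mult neg_power_step cong_refl)
  also have "[:d, 1:] ^ Suc j * smult d (neg_power j k d) = [:d:] * ([:d, 1:] ^ Suc j * neg_power j k d)"
    by simp
  also have "[\<dots> = [:d:] * [:d ^ (Suc k + j):]] (mod monom 1 (Suc k))"
    by (intro cong_mult Suc.IH cong_refl)
  finally show ?case by (simp only: power_Suc2 mult.assoc add_Suc_right) simp
qed

text \<open>By the hockey-stick identity the sum is a middle entry of row \<open>2 * k + 1\<close>.
  That entry occurs twice in the row, whose total is \<open>2 * 4 ^ k\<close>.\<close>

lemma sum_choose_le: "(\<Sum>m\<le>k. (k + m) choose m) \<le> 4 ^ k"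
proof -
  have "(\<Sum>m\<le>k. (k + m) choose m) = Suc (k + k) choose k"
    by (rule sum_choose_lower)
  also have "\<dots> \<le> 4 ^ k"
  proof -
    have "2 * (Suc (2 * k) choose k) = (\<Sum>i\<in>{k, Suc k}. Suc (2 * k) choose i)"
      using binomial_symmetric[of k "Suc (2 * k)"] by simp
    also have "\<dots> \<le> (\<Sum>i\<le>Suc (2 * k). Suc (2 * k) choose i)"
      by (rule sum_mono2) auto
    also have "\<dots> = 2 ^ Suc (2 * k)" by (rule choose_row_sum)
    also have "\<dots> = 2 * 4 ^ k" by (simp add: power_mult)
    finally show ?thesis by (simp add: mult_2)
  qed
  finally show ?thesis .
qed

lemma wnorm_neg_power:
  assumes "norm d \<le> r" shows "wnorm r (neg_power k k d) \<le> (4 * r) ^ k"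
proof -
  have r: "r \<ge> 0" using assms norm_ge_zero[of d] by linarith
  have "wnorm r (neg_power k k d) \<le> (\<Sum>m\<le>k. norm (coeff (neg_power k k d) m) * r ^ m)"
    by (rule wnorm_le_sum[OF r]) (simp add: coeff_neg_power)
  also have "\<dots> \<le> (\<Sum>m\<le>k. real ((k + m) choose m) * r ^ k)"
  proof (rule sum_mono)
    fix m assume m: "m \<in> {..k}"
    have "norm d ^ (k - m) * r ^ m \<le> r ^ (k - m) * r ^ m"
      using assms r by (intro mult_right_mono power_mono) auto
    also have "\<dots> = r ^ k" using m by (simp flip: power_add)
    finally have "real ((k + m) choose m) * (norm d ^ (k - m) * r ^ m) \<le> real ((k + m) choose m) * r ^ k"
      by (rule mult_left_mono) simp
    then show "norm (coeff (neg_power k k d) m) * r ^ m \<le> real ((k + m) choose m) * r ^ k"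
      using m by (simp add: coeff_neg_power norm_mult norm_power algebra_simps)
  qed
  also have "\<dots> = real (\<Sum>m\<le>k. (k + m) choose m) * r ^ k"
    by (simp add: sum_distrib_right)
  also have "\<dots> \<le> real (4 ^ k) * r ^ k"
    using sum_choose_le[of k] r by (intro mult_right_mono of_nat_mono) auto
  finally show ?thesis by (simp add: power_mult_distrib)
qed

subsection \<open>Hermite interpolation\<close>

definition node_prod :: "complex set \<Rightarrow> nat \<Rightarrow> complex \<Rightarrow> complex poly" where
  "node_prod S k s = (\<Prod>t\<in>S - {s}. [:- t, 1:] ^ Suc k)"

text \<open>Hermite interpolation with cleared denominators; \<open>g s\<close> is the local datum
  at \<open>s\<close> in the coordinate \<open>w = z - s\<close>. Inverting the other node factors
  modulo \<open>w ^ (k + 1)\<close> costs the denominator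
  \<open>(\<Prod>t. s - t) ^ (2 * k + 1)\<close>. A weight \<open>e s\<close> with
  \<open>e s * (\<Prod>t. s - t) = D\<close> for all \<open>s\<close> replaces it by the common
  multiplier \<open>D ^ (2 * k + 1)\<close>, so no division occurs.\<close>

definition interp :: "complex set \<Rightarrow> (complex \<Rightarrow> complex) \<Rightarrow> nat \<Rightarrow> (complex \<Rightarrow> complex poly) \<Rightarrow> complex poly" where
  "interp S e k g = (\<Sum>s\<in>S. smult (e s ^ (2 * k + 1)) (node_prod S k s *
      pcompose (poly_cutoff (Suc k) (g s * (\<Prod>t\<in>S - {s}. neg_power k k (s - t)))) [:- s, 1:]))"

lemma poly_cutoff_add: "poly_cutoff n (p + q) = poly_cutoff n p + poly_cutoff n q"
  by (rule poly_eqI) (simp add: coeff_poly_cutoff)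

lemma poly_cutoff_cong: "[poly_cutoff n p = (p :: complex poly)] (mod monom 1 n)"
  by (simp add: cong_monom_iff coeff_poly_cutoff)

lemma interp_add: "interp S e k (\<lambda>s. g s + h s) = interp S e k g + interp S e k h"
  by (simp add: interp_def distrib_right distrib_left poly_cutoff_add pcompose_add smult_add_right sum.distrib)

lemma degree_cutoff_le: "degree (poly_cutoff (Suc k) p) \<le> k"
  by (rule degree_le) (simp add: coeff_poly_cutoff)

lemma degree_node_prod_le: "finite S \<Longrightarrow> s \<in> S \<Longrightarrow> degree (node_prod S k s) \<le> (card S - 1) * Suc k"
  unfolding node_prod_def
  by (rule order.trans[OF degree_prod_sum_le]) (simp_all add: degree_linear_power del: power_Suc)

lemma degree_interp:
  assumes "finite S"
  shows "degree (interp S e k g) < card S * Suc k \<or> interp S e k g = 0"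
proof (cases "S = {}")
  case False
  then have c: "card S > 0" using assms by (simp add: card_gt_0_iff)
  have "degree (interp S e k g) \<le> (card S - 1) * Suc k + k"
    unfolding interp_def
  proof (intro degree_sum_le assms)
    fix s assume s: "s \<in> S"
    show "degree (smult (e s ^ (2 * k + 1)) (node_prod S k s *
      pcompose (poly_cutoff (Suc k) (g s * (\<Prod>t\<in>S - {s}. neg_power k k (s - t)))) [:- s, 1:]))
      \<le> (card S - 1) * Suc k + k"
      using degree_node_prod_le[OF assms s, of k] degree_cutoff_le[of k]
      by (intro order.trans[OF degree_smult_le] order.trans[OF degree_mult_le] add_mono)
         (auto simp: degree_pcompose)
  qed
  also have "\<dots> < card S * Suc k" using c by (cases "card S") auto
  finally show ?thesis by simp
qed (simp add: interp_def)

lemma pcompose_power: "pcompose (p ^ n) q = pcompose p q ^ n"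
  by (induction n) (auto simp: pcompose_1 pcompose_mult)

lemma pcompose_monom_shift: "pcompose (monom 1 n) [:- s, 1:] = [:- s, 1:] ^ n" for s :: complex
  by (simp add: monom_altdef pcompose_power pcompose_pCons)

lemma pcompose_cong:
  assumes "[p = q] (mod monom 1 n)"
  shows "[pcompose p [:- s, 1:] = pcompose q [:- s, 1:]] (mod ([:- s, 1:] :: complex poly) ^ n)"
proof -
  obtain r where "p - q = monom 1 n * r" using assms by (auto simp: cong_iff_dvd_diff)
  then have "pcompose p [:- s, 1:] - pcompose q [:- s, 1:] = [:- s, 1:] ^ n * pcompose r [:- s, 1:]"
    by (metis pcompose_diff pcompose_monom_shift pcompose_mult)
  then show ?thesis by (simp add: cong_iff_dvd_diff)
qed

text \<open>Modulo the node power of \<open>s\<close> all summands of other nodes vanish. In the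
  remaining one, \<open>node_prod\<close> and the truncated inverses collapse to a constant, which
  \<open>e s ^ (2 * k + 1)\<close> completes to \<open>D ^ (2 * k + 1)\<close>.\<close>

lemma interp_cong:
  assumes S: "finite S" "s \<in> S" and D: "e s * (\<Prod>t\<in>S - {s}. s - t) = D"
  shows "[interp S e k g = smult (D ^ (2 * k + 1)) (pcompose (g s) [:- s, 1:])] (mod [:- s, 1:] ^ Suc k)"
proof -
  define L where "L = ([:- s, 1:] :: complex poly)"
  define J where "J = (\<lambda>s. \<Prod>t\<in>S - {s}. neg_power k k (s - t))"
  define F where "F = (\<lambda>s. smult (e s ^ (2 * k + 1)) (node_prod S k s *
      pcompose (poly_cutoff (Suc k) (g s * J s)) [:- s, 1:]))"
  have other: "[F t = 0] (mod L ^ Suc k)" if "t \<in> S - {s}" for t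
  proof -
    have "L ^ Suc k dvd node_prod S k t"
      unfolding node_prod_def L_def using that S by (intro dvd_prodI) auto
    then have "L ^ Suc k dvd F t" unfolding F_def by (intro dvd_smult dvd_mult2)
    then show ?thesis by (simp add: cong_0_iff)
  qed
  \<comment> \<open>In the coordinate \<open>w = z - s\<close> the factor of a node \<open>t\<close>
    becomes \<open>(s - t + w) ^ (k + 1)\<close>, the form inverted by
    \<open>neg_power_cong\<close>.\<close>
  have "node_prod S k s = pcompose (\<Prod>t\<in>S - {s}. [:s - t, 1:] ^ Suc k) L"
    unfolding node_prod_def L_def
    by (simp add: pcompose_prod pcompose_power pcompose_pCons del: power_Suc)
  then have Fs: "F s = pcompose ((\<Prod>t\<in>S - {s}. [:s - t, 1:] ^ Suc k) *
      ([:e s ^ (2 * k + 1):] * poly_cutoff (Suc k) (g s * J s))) L"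
    unfolding F_def L_def[symmetric] by (simp add: pcompose_mult pcompose_smult)
  have "[(\<Prod>t\<in>S - {s}. [:s - t, 1:] ^ Suc k) * ([:e s ^ (2 * k + 1):] * poly_cutoff (Suc k) (g s * J s))
      = (\<Prod>t\<in>S - {s}. [:s - t, 1:] ^ Suc k) * ([:e s ^ (2 * k + 1):] * (g s * J s))] (mod monom 1 (Suc k))"
    by (intro cong_mult cong_refl poly_cutoff_cong)
  also have "(\<Prod>t\<in>S - {s}. [:s - t, 1:] ^ Suc k) * ([:e s ^ (2 * k + 1):] * (g s * J s)) =
      [:e s ^ (2 * k + 1):] * g s * (\<Prod>t\<in>S - {s}. [:s - t, 1:] ^ Suc k * neg_power k k (s - t))"
    unfolding J_def prod.distrib by (simp only: ac_simps)
  also have "[\<dots> = [:e s ^ (2 * k + 1):] * g s * (\<Prod>t\<in>S - {s}. [:(s - t) ^ (Suc k + k):])] (mod monom 1 (Suc k))"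
    by (intro cong_mult cong_refl cong_prod neg_power_cong)
  also have "(\<Prod>t\<in>S - {s}. [:(s - t) ^ (Suc k + k):]) = [:(\<Prod>t\<in>S - {s}. s - t) ^ (2 * k + 1):]"
  proof -
    have "(\<Prod>t\<in>A. [:h t:]) = [:\<Prod>t\<in>A. h t:]" for A and h :: "complex \<Rightarrow> complex"
      by (induction A rule: infinite_finite_induct) (auto simp: one_pCons)
    then show ?thesis by (simp add: prod_power_distrib mult_2 prod.distrib)
  qed
  also have "[:e s ^ (2 * k + 1):] * g s * [:(\<Prod>t\<in>S - {s}. s - t) ^ (2 * k + 1):] = smult (D ^ (2 * k + 1)) (g s)"
    by (simp add: D[symmetric] power_mult_distrib algebra_simps)
  finally have "[F s = pcompose (smult (D ^ (2 * k + 1)) (g s)) L] (mod L ^ Suc k)"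
    unfolding Fs L_def by (rule pcompose_cong)
  moreover have "[(\<Sum>t\<in>S - {s}. F t) = (\<Sum>t\<in>S - {s}. 0)] (mod L ^ Suc k)"
    by (intro cong_sum other)
  ultimately have "[F s + (\<Sum>t\<in>S - {s}. F t) = pcompose (smult (D ^ (2 * k + 1)) (g s)) L + (\<Sum>t\<in>S - {s}. 0)] (mod L ^ Suc k)"
    by (rule cong_add)
  moreover have "interp S e k g = F s + (\<Sum>t\<in>S - {s}. F t)"
    unfolding interp_def F_def J_def using S by (simp add: sum.remove)
  ultimately show ?thesis by (simp add: pcompose_smult L_def)
qed

lemma node_powers_dvd_imp_degree:
  fixes p :: "complex poly"
  assumes "finite S" "p \<noteq> 0" "\<And>s. s \<in> S \<Longrightarrow> [:- s, 1:] ^ n dvd p"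
  shows "card S * n \<le> degree p"
proof (cases "n = 0")
  case False
  have "card S * n = (\<Sum>s\<in>S. n)" by simp
  also have "\<dots> \<le> (\<Sum>s\<in>S. order s p)"
    using assms by (intro sum_mono) (simp add: order_divides)
  also have "\<dots> \<le> (\<Sum>s | poly p s = 0. order s p)"
    using assms False by (intro sum_mono2 poly_roots_finite)
      (auto, metis dvd_trans poly_eq_0_iff_dvd dvd_power zero_less_iff_neq_zero)
  also have "\<dots> \<le> degree p"
    using assms(2) by (rule sum_order_le_degree)
  finally show ?thesis .
qed simp

lemma (in discrete_ring) interp_polys:
  assumes "\<And>s. s \<in> S \<Longrightarrow> s \<in> R" "\<And>s. s \<in> S \<Longrightarrow> e s \<in> R" "\<And>s. s \<in> S \<Longrightarrow> g s \<in> polys"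
  shows "interp S e k g \<in> polys"
  unfolding interp_def node_prod_def neg_power_def
  using assms
  by (intro sum_polys smult_polys mult_polys prod_polys pcompose_polys power_polys cutoff_polys
       monom_polys pCons_polys power_mem mult_mem of_nat_mem zero_polys uminus_mem one_mem diff_mem) auto

text \<open>The three powers bound the weights, the node product at radius \<open>r\<close> and the
  truncated inverses. Local factors are measured at radius \<open>2 * r\<close> because of the shift
  by \<open>s\<close>.\<close>

lemma wnorm_interp:
  assumes S: "finite S" and r: "r > 0" "\<And>s. s \<in> S \<Longrightarrow> norm s \<le> r" "\<And>s. s \<in> S \<Longrightarrow> norm (e s) \<le> 2 * r"
  shows "wnorm r (interp S e k g) \<le>
    (2 * r) ^ (2 * k + 1) * (2 * r) ^ ((card S - 1) * Suc k) * (8 * r) ^ ((card S - 1) * k) * (\<Sum>s\<in>S. wnorm (2 * r) (g s))"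
proof -
  define J where "J = (\<lambda>s. \<Prod>t\<in>S - {s}. neg_power k k (s - t))"
  define C where "C = (2 * r) ^ (2 * k + 1) * (2 * r) ^ ((card S - 1) * Suc k) * (8 * r) ^ ((card S - 1) * k)"
  have lin: "wnorm r [:- t, 1:] \<le> 2 * r" if "t \<in> S" for t using r that by auto
  have "wnorm r (interp S e k g) \<le> (\<Sum>s\<in>S. wnorm r (smult (e s ^ (2 * k + 1)) (node_prod S k s *
      pcompose (poly_cutoff (Suc k) (g s * J s)) [:- s, 1:])))"
    unfolding interp_def J_def using r by (intro wnorm_sum) auto
  also have "\<dots> \<le> (\<Sum>s\<in>S. C * wnorm (2 * r) (g s))"
  proof (rule sum_mono)
    fix s assume s: "s \<in> S"
    have c: "card (S - {s}) = card S - 1" using S s by simp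
    have "wnorm r (node_prod S k s) \<le> (\<Prod>t\<in>S - {s}. wnorm r ([:- t, 1:] ^ Suc k))"
      unfolding node_prod_def using r by (intro wnorm_prod) auto
    also have "\<dots> \<le> (\<Prod>t\<in>S - {s}. (2 * r) ^ Suc k)"
    proof (intro prod_mono conjI)
      fix t assume t: "t \<in> S - {s}"
      show "0 \<le> wnorm r ([:- t, 1:] ^ Suc k)" using r by simp
      have "wnorm r ([:- t, 1:] ^ Suc k) \<le> wnorm r [:- t, 1:] ^ Suc k" using r by (intro wnorm_power) auto
      also have "\<dots> \<le> (2 * r) ^ Suc k" using lin t r by (intro power_mono wnorm_nonneg) auto
      finally show "wnorm r ([:- t, 1:] ^ Suc k) \<le> (2 * r) ^ Suc k" .
    qed
    also have "\<dots> = (2 * r) ^ ((card S - 1) * Suc k)" by (simp only: c prod_constant power_mult[symmetric] mult.commute)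
    finally have 1: "wnorm r (node_prod S k s) \<le> (2 * r) ^ ((card S - 1) * Suc k)" .
    have "wnorm (2 * r) (J s) \<le> (\<Prod>t\<in>S - {s}. wnorm (2 * r) (neg_power k k (s - t)))"
      unfolding J_def using r by (intro wnorm_prod) auto
    also have "\<dots> \<le> (\<Prod>t\<in>S - {s}. (8 * r) ^ k)"
    proof (intro prod_mono conjI)
      fix t assume t: "t \<in> S - {s}"
      show "0 \<le> wnorm (2 * r) (neg_power k k (s - t))" using r by simp
      have "norm (s - t) \<le> 2 * r"
        using norm_triangle_ineq4[of s t] r(2)[of s] r(2)[of t] s t by simp
      from wnorm_neg_power[OF this] show "wnorm (2 * r) (neg_power k k (s - t)) \<le> (8 * r) ^ k"
        by (simp only: mult.assoc[symmetric]) simp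
    qed
    also have "\<dots> = (8 * r) ^ ((card S - 1) * k)" by (simp only: c prod_constant power_mult[symmetric] mult.commute)
    finally have 2: "wnorm (2 * r) (J s) \<le> (8 * r) ^ ((card S - 1) * k)" .
    have "wnorm r (pcompose (poly_cutoff (Suc k) (g s * J s)) [:- s, 1:]) \<le>
        wnorm (wnorm r [:- s, 1:]) (poly_cutoff (Suc k) (g s * J s))"
      using r by (intro wnorm_pcompose) auto
    also have "\<dots> \<le> wnorm (2 * r) (poly_cutoff (Suc k) (g s * J s))"
      using r lin[OF s] by (intro wnorm_mono) auto
    also have "\<dots> \<le> wnorm (2 * r) (g s * J s)" using r by (intro wnorm_cutoff) auto
    also have "\<dots> \<le> wnorm (2 * r) (g s) * wnorm (2 * r) (J s)" using r by (intro wnorm_mult) auto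
    also have "\<dots> \<le> wnorm (2 * r) (g s) * (8 * r) ^ ((card S - 1) * k)"
      using r 2 by (intro mult_left_mono) auto
    finally have 3: "wnorm r (pcompose (poly_cutoff (Suc k) (g s * J s)) [:- s, 1:]) \<le>
       wnorm (2 * r) (g s) * (8 * r) ^ ((card S - 1) * k)" .
    have "wnorm r (node_prod S k s * pcompose (poly_cutoff (Suc k) (g s * J s)) [:- s, 1:]) \<le>
       wnorm r (node_prod S k s) * wnorm r (pcompose (poly_cutoff (Suc k) (g s * J s)) [:- s, 1:])"
      using r by (intro wnorm_mult) auto
    also have "\<dots> \<le> (2 * r) ^ ((card S - 1) * Suc k) * (wnorm (2 * r) (g s) * (8 * r) ^ ((card S - 1) * k))"
      using r by (intro mult_mono 1 3) auto
    finally have 4: "wnorm r (node_prod S k s * pcompose (poly_cutoff (Suc k) (g s * J s)) [:- s, 1:]) \<le> \<dots>" .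
    have "wnorm r (smult (e s ^ (2 * k + 1)) (node_prod S k s *
      pcompose (poly_cutoff (Suc k) (g s * J s)) [:- s, 1:])) \<le> (2 * r) ^ (2 * k + 1) *
      ((2 * r) ^ ((card S - 1) * Suc k) * (wnorm (2 * r) (g s) * (8 * r) ^ ((card S - 1) * k)))"
      unfolding wnorm_smult norm_power using r s by (intro mult_mono 4 power_mono) auto
    then show "wnorm r (smult (e s ^ (2 * k + 1)) (node_prod S k s *
      pcompose (poly_cutoff (Suc k) (g s * J s)) [:- s, 1:])) \<le> C * wnorm (2 * r) (g s)"
      unfolding C_def by (simp only: ac_simps)
  qed
  also have "\<dots> = C * (\<Sum>s\<in>S. wnorm (2 * r) (g s))" by (simp add: sum_distrib_left)
  finally show ?thesis unfolding C_def .
qed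

subsection \<open>Binomial coefficients of half-integers\<close>

lemma gbinomial_Suc_rec: "of_nat (Suc h) * (a gchoose Suc h) = (a - of_nat h) * (a gchoose h)"
  for a :: "'a::field_char_0"
  using gbinomial_mult_1[of a h] by (simp add: algebra_simps)

lemma gbinomial_minus_half: "4 ^ h * ((- 1 / 2) gchoose h) = (- 1) ^ h * (of_nat ((2 * h) choose h) :: complex)"
proof (induction h)
  case (Suc h)
  have "Suc h * ((2 * Suc h) choose Suc h) = 2 * Suc h * (Suc (2 * h) choose h)"
    using Suc_times_binomial[of h "Suc (2 * h)"] by simp
  then have "((2 * Suc h) choose Suc h) = 2 * (Suc (2 * h) choose h)"
    by (metis mult.assoc mult.left_commute mult_left_cancel nat.distinct(1))
  moreover have "Suc h * (Suc (2 * h) choose h) = Suc (2 * h) * ((2 * h) choose h)"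
  proof -
    have "(Suc (2 * h) choose h) = (Suc (2 * h) choose Suc h)"
      using binomial_symmetric[of h "Suc (2 * h)"] by simp
    then show ?thesis using Suc_times_binomial[of h "2 * h"] by simp
  qed
  ultimately have "Suc h * ((2 * Suc h) choose Suc h) = 2 * (Suc (2 * h) * ((2 * h) choose h))"
    by (simp only: mult.left_commute)
  then have "Suc h * ((2 * Suc h) choose Suc h) = 2 * (2 * h + 1) * ((2 * h) choose h)"
    by (simp only: mult.assoc Suc_eq_plus1)
  from arg_cong[OF this, of "of_nat :: nat \<Rightarrow> complex"]
  have b: "of_nat (Suc h) * (of_nat ((2 * Suc h) choose Suc h) :: complex)
      = 2 * (2 * of_nat h + 1) * of_nat ((2 * h) choose h)"
    by (simp only: of_nat_mult of_nat_add of_nat_1 of_nat_numeral)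
  have "of_nat (Suc h) * (4 ^ Suc h * ((- 1 / 2) gchoose Suc h) :: complex) =
      4 * 4 ^ h * (of_nat (Suc h) * ((- 1 / 2) gchoose Suc h))"
    by (simp only: power_Suc ac_simps)
  also have "\<dots> = 4 * (- 1 / 2 - of_nat h) * (4 ^ h * ((- 1 / 2) gchoose h))"
    by (subst gbinomial_Suc_rec) (simp only: ac_simps)
  also have "\<dots> = (- 1) ^ Suc h * (2 * (2 * of_nat h + 1) * of_nat ((2 * h) choose h))"
    unfolding Suc.IH by (simp add: algebra_simps)
  also have "\<dots> = of_nat (Suc h) * ((- 1) ^ Suc h * of_nat ((2 * Suc h) choose Suc h))"
    unfolding b[symmetric] by (simp only: ac_simps)
  finally show ?case
    by (metis mult_left_cancel of_nat_eq_0_iff nat.distinct(1))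
qed simp

text \<open>Pascal's rule raises the upper argument by 1; the induction starts from the signed
  central binomial coefficients at \<open>- 1 / 2\<close>.\<close>

lemma gbinomial_half_Ints: "4 ^ h * ((of_nat k - 1 / 2) gchoose h) \<in> (\<int> :: complex set)"
proof (induction k arbitrary: h)
  case 0
  then show ?case using gbinomial_minus_half[of h] by simp
next
  case (Suc k)
  show ?case
  proof (cases h)
    case (Suc i)
    have "(of_nat (Suc k) - 1 / 2 :: complex) = (of_nat k - 1 / 2) + 1" by simp
    then have "(4 :: complex) ^ h * ((of_nat (Suc k) - 1 / 2) gchoose h) =
        4 * (4 ^ i * ((of_nat k - 1 / 2) gchoose i)) + 4 ^ Suc i * ((of_nat k - 1 / 2) gchoose Suc i)"
      by (simp only: Suc gbinomial_Suc_Suc) (simp add: algebra_simps)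
    then show ?thesis using Suc.IH[of i] Suc.IH[of "Suc i"] by (simp only: Ints_add Ints_mult Ints_numeral)
  qed simp
qed

text \<open>At \<open>- 1 / 2\<close> consecutive coefficients have a ratio of absolute value at
  most 1; each use of Pascal's rule at most doubles the bound.\<close>

lemma norm_gbinomial_half_le: "norm ((of_nat k - 1 / 2 :: complex) gchoose h) \<le> 2 ^ k"
proof (induction k arbitrary: h)
  case 0
  have "norm ((- 1 / 2 :: complex) gchoose h) \<le> 1"
  proof (induction h)
    case (Suc h)
    have "real (Suc h) * norm ((- 1 / 2 :: complex) gchoose Suc h) = norm ((- 1 / 2 - of_nat h) * ((- 1 / 2 :: complex) gchoose h))"
      unfolding gbinomial_Suc_rec[symmetric] by (simp only: norm_mult norm_of_nat)
    also have "\<dots> \<le> norm (- 1 / 2 - of_nat h :: complex) * 1"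
      unfolding norm_mult by (intro mult_left_mono Suc.IH) auto
    also have "\<dots> \<le> real (Suc h)"
    proof -
      have "norm (- 1 / 2 - of_nat h :: complex) \<le> norm (- 1 / 2 :: complex) + norm (of_nat h :: complex)"
        by (rule norm_triangle_ineq4)
      then show ?thesis by simp
    qed
    finally show ?case by (simp add: mult_le_cancel_left1)
  qed simp
  then show ?case by simp
next
  case (Suc k)
  show ?case
  proof (cases h)
    case (Suc i)
    have "(of_nat (Suc k) - 1 / 2 :: complex) = (of_nat k - 1 / 2) + 1" by simp
    then have "((of_nat (Suc k) - 1 / 2 :: complex) gchoose h) =
        ((of_nat k - 1 / 2) gchoose i) + ((of_nat k - 1 / 2) gchoose Suc i)"
      by (simp only: Suc gbinomial_Suc_Suc)
    also have "norm \<dots> \<le> 2 ^ k + 2 ^ k"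
      by (intro norm_triangle_mono Suc.IH)
    finally show ?thesis by simp
  qed (use one_le_power[of "2::real" "Suc k"] in simp)
qed

subsection \<open>Local expansions of half-integral powers\<close>

text \<open>The expansion of \<open>4 ^ k * (M + w) powr (k + 1 / 2) / M powr (1 / 2)\<close> modulo \<open>w ^ (k + 1)\<close>.\<close>

definition half_power :: "nat \<Rightarrow> complex \<Rightarrow> complex poly" where
  "half_power k M = (\<Sum>h\<le>k. monom (4 ^ k * ((of_nat k + 1 / 2) gchoose h) * M ^ (k - h)) h)"

lemma coeff_half_power:
  "coeff (half_power k M) h = (if h \<le> k then 4 ^ k * ((of_nat k + 1 / 2) gchoose h) * M ^ (k - h) else 0)"
  by (simp add: half_power_def coeff_sum)

lemma half_power_polys:
  assumes "discrete_ring R" "M \<in> R"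
  shows "half_power k M \<in> discrete_ring.polys R"
proof -
  interpret discrete_ring R by fact
  have "4 ^ k * ((of_nat k + 1 / 2) gchoose h) * M ^ (k - h) \<in> R" if "h \<le> k" for h
  proof -
    have *: "(of_nat k + 1 / 2 :: complex) = of_nat (Suc k) - 1 / 2" by simp
    have "(4 :: complex) ^ k * ((of_nat k + 1 / 2) gchoose h) = 4 ^ (k - h) * (4 ^ h * ((of_nat (Suc k) - 1 / 2) gchoose h))"
      unfolding * using that by (simp only: mult.assoc[symmetric] power_add[symmetric]) simp
    also have "\<dots> \<in> \<int>" by (intro Ints_mult Ints_power gbinomial_half_Ints) auto
    finally have "(4 :: complex) ^ k * ((of_nat k + 1 / 2) gchoose h) \<in> R"
      using of_int_mem unfolding Ints_def by (metis imageE)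
    then show ?thesis using assms(2) by (rule mult_mem[OF _ power_mem])
  qed
  then show ?thesis by (intro polysI) (auto simp: coeff_half_power zero_mem)
qed

text \<open>The differential equation of \<open>(M + w) powr (k + 1 / 2)\<close>. One order is lost:
  the coefficient of \<open>w ^ k\<close> on the left would involve that of
  \<open>w ^ (k + 1)\<close>, which was truncated.\<close>

lemma half_power_ode:
  "[[:M, 1:] * pderiv (half_power k M) = smult (of_nat k + 1 / 2) (half_power k M)] (mod monom 1 k)"
  unfolding cong_monom_iff
proof (intro allI impI)
  fix h assume h: "h < k"
  define \<alpha> where "\<alpha> = (of_nat k + 1 / 2 :: complex)"
  have "coeff ([:M, 1:] * pderiv (half_power k M)) h = M * coeff (pderiv (half_power k M)) h +
      of_nat h * coeff (half_power k M) h"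
    by (cases h) (simp_all add: coeff_pderiv algebra_simps)
  also have "M * coeff (pderiv (half_power k M)) h =
      4 ^ k * (of_nat (Suc h) * (\<alpha> gchoose Suc h)) * (M * M ^ (k - Suc h))"
    using h by (simp only: coeff_pderiv coeff_half_power \<alpha>_def Suc_le_eq if_True ac_simps)
  also have "M * M ^ (k - Suc h) = M ^ (k - h)"
    using h by (simp add: Suc_diff_Suc flip: power_Suc)
  also have "4 ^ k * (of_nat (Suc h) * (\<alpha> gchoose Suc h)) * M ^ (k - h) + of_nat h * coeff (half_power k M) h
     = \<alpha> * coeff (half_power k M) h"
    using h unfolding gbinomial_Suc_rec by (simp add: coeff_half_power \<alpha>_def algebra_simps)
  finally show "coeff ([:M, 1:] * pderiv (half_power k M)) h = coeff (smult (of_nat k + 1 / 2) (half_power k M)) h"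
    by (simp add: \<alpha>_def)
qed

lemma sum_powers_le:
  fixes x y :: real
  assumes "x \<ge> 0" "y \<ge> 0"
  shows "(\<Sum>h\<le>k. x ^ (k - h) * y ^ h) \<le> (x + y) ^ k"
proof -
  have "(\<Sum>h\<le>k. x ^ (k - h) * y ^ h) \<le> (\<Sum>h\<le>k. of_nat (k choose h) * y ^ h * x ^ (k - h))"
  proof (rule sum_mono)
    fix h assume "h \<in> {..k}"
    then have "1 \<le> real (k choose h)" by (simp add: Suc_le_eq zero_less_binomial_iff)
    then have "1 * (y ^ h * x ^ (k - h)) \<le> real (k choose h) * (y ^ h * x ^ (k - h))"
      using assms by (intro mult_right_mono) auto
    then show "x ^ (k - h) * y ^ h \<le> of_nat (k choose h) * y ^ h * x ^ (k - h)" by (simp add: algebra_simps)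
  qed
  also have "\<dots> = (x + y) ^ k" using binomial_ring[of y x k] by (simp add: add.commute)
  finally show ?thesis .
qed

lemma wnorm_half_power:
  assumes "r \<ge> 0" shows "wnorm r (half_power k M) \<le> 2 * 8 ^ k * (norm M + r) ^ k"
proof -
  have "wnorm r (half_power k M) \<le> (\<Sum>h\<le>k. norm (coeff (half_power k M) h) * r ^ h)"
    by (rule wnorm_le_sum[OF assms]) (simp add: coeff_half_power)
  also have "\<dots> \<le> (\<Sum>h\<le>k. 2 * 8 ^ k * (norm M ^ (k - h) * r ^ h))"
  proof (rule sum_mono)
    fix h assume h: "h \<in> {..k}"
    have "norm ((of_nat k + 1 / 2 :: complex) gchoose h) \<le> 2 ^ Suc k"
      using norm_gbinomial_half_le[of "Suc k" h] by (simp add: add.commute)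
    then have "4 ^ k * norm ((of_nat k + 1 / 2 :: complex) gchoose h) * (norm M ^ (k - h) * r ^ h)
      \<le> 4 ^ k * 2 ^ Suc k * (norm M ^ (k - h) * r ^ h)"
      using assms by (intro mult_right_mono mult_left_mono) auto
    also have "(4 :: real) ^ k * 2 ^ Suc k = 2 * 8 ^ k" by (simp flip: power_mult_distrib)
    finally show "norm (coeff (half_power k M) h) * r ^ h \<le> 2 * 8 ^ k * (norm M ^ (k - h) * r ^ h)"
      using h by (simp add: coeff_half_power norm_mult norm_power mult.assoc)
  qed
  also have "\<dots> = 2 * 8 ^ k * (\<Sum>h\<le>k. norm M ^ (k - h) * r ^ h)" by (simp add: sum_distrib_left)
  also have "\<dots> \<le> 2 * 8 ^ k * (norm M + r) ^ k" using assms by (intro mult_left_mono sum_powers_le) auto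
  finally show ?thesis .
qed

subsection \<open>Non-vanishing\<close>

text \<open>If the interpolating polynomial \<open>I\<close> had degree below \<open>card S * k\<close>, then the polynomial
  \<open>(N + z) * I' - (k + 1 / 2) * I\<close>, which vanishes to order \<open>k\<close> at every node, would be zero;
  but this differential equation has no nonzero polynomial solution.\<close>

lemma interp_half_power_degree:
  fixes k :: nat and S :: "complex set"
  assumes S: "finite S" and s: "s \<in> S" and p: "p s \<noteq> 0" and N: "N + s \<noteq> 0" and "D \<noteq> 0"
    and D: "\<And>s. s \<in> S \<Longrightarrow> e s * (\<Prod>t\<in>S - {s}. s - t) = D"
  defines "I \<equiv> interp S e k (\<lambda>s. smult (p s) (half_power k (N + s)))"
  shows "card S * k \<le> degree I" "I \<noteq> 0"
proof -
  define \<alpha> where "\<alpha> = (of_nat k + 1 / 2 :: complex)"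
  have cong: "[I = smult (D ^ (2 * k + 1)) (pcompose (smult (p s) (half_power k (N + s))) [:- s, 1:])] (mod [:- s, 1:] ^ Suc k)"
    if "s \<in> S" for s
    unfolding I_def using interp_cong[of S s e D k "\<lambda>s. smult (p s) (half_power k (N + s))", OF S that D[OF that]] .
  show "I \<noteq> 0"
  proof
    \<comment> \<open>At the given node \<open>s\<close> the interpolant takes the value
      \<open>D ^ (2 * k + 1) * p s * 4 ^ k * (N + s) ^ k\<close>, which is nonzero.\<close>
    assume "I = 0"
    then have "[:- s, 1:] ^ Suc k dvd smult (D ^ (2 * k + 1)) (pcompose (smult (p s) (half_power k (N + s))) [:- s, 1:])"
      using cong[OF s] by (metis cong_0_iff cong_sym)
    then have "[:- s, 1:] dvd smult (D ^ (2 * k + 1)) (pcompose (smult (p s) (half_power k (N + s))) [:- s, 1:])"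
      by (rule dvd_trans[rotated]) (rule dvd_power, simp)
    then have "poly (smult (D ^ (2 * k + 1)) (pcompose (smult (p s) (half_power k (N + s))) [:- s, 1:])) s = 0"
      by (simp only: poly_eq_0_iff_dvd)
    then have "poly (half_power k (N + s)) 0 = 0" using p \<open>D \<noteq> 0\<close> by (simp add: poly_pcompose)
    moreover have "poly (half_power k (N + s)) 0 = 4 ^ k * (N + s) ^ k"
      by (simp add: poly_0_coeff_0 coeff_half_power)
    ultimately show False using N by simp
  qed
  show "card S * k \<le> degree I"
  proof (rule ccontr)
    assume deg: "\<not> card S * k \<le> degree I"
    define M where "M = [:N, 1:] * pderiv I - smult \<alpha> I"
    have "[:- s, 1:] ^ k dvd M" if "s \<in> S" for s
    proof -
      define L where "L = ([:- s, 1:] :: complex poly)"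
      define g where "g = smult (D ^ (2 * k + 1) * p s) (half_power k (N + s))"
      have "L ^ Suc k dvd I - pcompose g L"
        using cong[OF that] by (simp add: cong_iff_dvd_diff g_def pcompose_smult L_def)
      \<comment> \<open>Near the node, \<open>I\<close> is the truncated half power plus a term of
        order \<open>k + 1\<close>. The differential operator kills the former modulo
        \<open>L ^ k\<close> and lowers the order of the latter by at most 1.\<close>
      then obtain Q where Q: "I = pcompose g L + L ^ Suc k * Q"
        by (metis dvdE diff_eq_eq add.commute)
      have L': "pderiv L = 1" by (simp add: L_def pderiv_pCons one_pCons)
      have Lk: "pderiv (L ^ Suc k) = smult (of_nat (Suc k)) (L ^ k)"
        by (simp only: pderiv_power_Suc L' mult_1_right)
      have NL: "[:N, 1:] = pcompose [:N + s, 1:] L" by (simp add: L_def pcompose_pCons)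
      have "M = [:N, 1:] * pcompose (pderiv g) L + [:N, 1:] * (L ^ Suc k * pderiv Q + smult (of_nat (Suc k)) (L ^ k) * Q)
          - smult \<alpha> (pcompose g L) - smult \<alpha> (L ^ Suc k * Q)"
        unfolding M_def Q pderiv_add pderiv_mult Lk pderiv_pcompose L'
        by (simp add: algebra_simps smult_add_right)
      also have "\<dots> = pcompose ([:N + s, 1:] * pderiv g - smult \<alpha> g) L +
          L ^ k * ([:N, 1:] * (L * pderiv Q + smult (of_nat (Suc k)) Q) - smult \<alpha> (L * Q))"
        unfolding NL pcompose_diff pcompose_mult pcompose_smult
        by (simp add: algebra_simps smult_diff_right smult_add_right del: pcompose_pCons)
      finally have M: "M = pcompose ([:N + s, 1:] * pderiv g - smult \<alpha> g) L +
          L ^ k * ([:N, 1:] * (L * pderiv Q + smult (of_nat (Suc k)) Q) - smult \<alpha> (L * Q))" .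
      have "[[:D ^ (2 * k + 1) * p s:] * ([:N + s, 1:] * pderiv (half_power k (N + s)))
          = [:D ^ (2 * k + 1) * p s:] * smult \<alpha> (half_power k (N + s))] (mod monom 1 k)"
        unfolding \<alpha>_def by (intro cong_mult cong_refl half_power_ode)
      then have "[[:N + s, 1:] * pderiv g - smult \<alpha> g = 0] (mod monom 1 k)"
        by (simp add: g_def pderiv_smult cong_iff_dvd_diff mult.commute)
      then have "[pcompose ([:N + s, 1:] * pderiv g - smult \<alpha> g) L = 0] (mod L ^ k)"
        unfolding L_def using pcompose_cong by fastforce
      then have "L ^ k dvd M" unfolding M by (simp add: cong_0_iff)
      then show ?thesis by (simp add: L_def)
    qed
    moreover have "degree M \<le> degree I"
    proof (rule degree_le, intro allI impI)
      fix i assume "degree I < i"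
      then show "coeff M i = 0"
        by (cases i) (auto simp: M_def coeff_pderiv coeff_eq_0)
    qed
    ultimately have "M = 0" using node_powers_dvd_imp_degree[OF S, of M k] deg by fastforce
    then have "coeff M (degree I) = 0" by simp
    \<comment> \<open>Comparing leading terms forces \<open>degree I = k + 1 / 2\<close>, impossible
      by parity.\<close>
    moreover have "coeff M (degree I) = (of_nat (degree I) - \<alpha>) * lead_coeff I"
      by (cases "degree I") (auto simp: M_def coeff_pderiv coeff_eq_0 algebra_simps)
    ultimately have "of_nat (degree I) = \<alpha>" using \<open>I \<noteq> 0\<close> by simp
    then have "(of_nat (2 * degree I) :: complex) = of_nat (2 * k + 1)" by (simp add: \<alpha>_def)
    then have "2 * degree I = 2 * k + 1" by (simp only: of_nat_eq_iff)
    then show False by presburger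
  qed
qed

subsection \<open>Simultaneous approximation\<close>

text \<open>Both sides are the coefficient of \<open>w ^ h\<close> in
  \<open>(1 + (s + w) / N) powr a\<close>, expanded around 0 on the left and around \<open>s\<close>
  on the right.\<close>

lemma gbinomial_trinomial_revision_sums:
  fixes N s a :: complex
  assumes "norm (s / N) < 1"
  shows "(\<lambda>m. (a gchoose m) / N ^ m * (of_nat (m choose h) * s ^ (m - h))) sums
    ((a gchoose h) / N ^ h * (1 + s / N) powr (a - of_nat h))"
proof -
  have "(\<lambda>m. (a gchoose h) / N ^ h * ((a - of_nat h gchoose m) * (s / N) ^ m)) sums
    ((a gchoose h) / N ^ h * (1 + s / N) powr (a - of_nat h))"
    by (intro sums_mult gen_binomial_complex assms)
  also have "(\<lambda>m. (a gchoose h) / N ^ h * ((a - of_nat h gchoose m) * (s / N) ^ m)) =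
     (\<lambda>m. (a gchoose (m + h)) / N ^ (m + h) * (of_nat ((m + h) choose h) * s ^ (m + h - h)))"
  proof
    fix m
    have "(a gchoose (m + h)) * of_nat ((m + h) choose h) = (a gchoose h) * (a - of_nat h gchoose m)"
      using gbinomial_trinomial_revision[of h "m + h" a] by (simp add: binomial_gbinomial)
    then show "(a gchoose h) / N ^ h * ((a - of_nat h gchoose m) * (s / N) ^ m) =
      (a gchoose (m + h)) / N ^ (m + h) * (of_nat ((m + h) choose h) * s ^ (m + h - h))"
      by (simp add: power_divide power_add mult_ac)
  qed
  finally show ?thesis
    by (subst (asm) sums_zero_iff_shift) (auto simp: binomial_eq_0)
qed

text \<open>After scaling by \<open>(1 + s / N) powr (1 / 2)\<close> the half power is the local
  expansion at \<open>s\<close> of \<open>(4 * N) ^ k * (1 + z / N) powr (k + 1 / 2)\<close>.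
  Removing the partial sum \<open>T\<close> leaves a series tail. With \<open>norm s \<le> r\<close>
  and \<open>w\<close> weighted by \<open>2 * r\<close>, it is dominated by a geometric series of
  ratio \<open>3 * r / norm N\<close>.\<close>

lemma half_power_tail:
  fixes N s :: complex and k n :: nat
  defines "T \<equiv> \<Sum>m<n. monom ((of_nat k + 1 / 2 gchoose m) / N ^ m) m"
  assumes r: "r > 0" "norm s \<le> r" "6 * r \<le> norm N"
  shows "wnorm (2 * r) (smult ((1 + s / N) powr (1 / 2)) (half_power k (N + s)) -
      smult ((4 * N) ^ k) (poly_cutoff (Suc k) (pcompose T [:s, 1:]))) \<le> 4 * (8 * norm N) ^ k * (3 * r / norm N) ^ n"
    (is "wnorm _ ?P \<le> _")
proof -
  define \<alpha> where "\<alpha> = (of_nat k + 1 / 2 :: complex)"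
  define c where "c = (\<lambda>h m. (\<alpha> gchoose m) / N ^ m * (of_nat (m choose h) * s ^ (m - h)))"
  define X where "X = (\<lambda>h. (\<alpha> gchoose h) / N ^ h * (1 + s / N) powr (\<alpha> - of_nat h))"
  \<comment> \<open>Majorant of \<open>c h (m + n)\<close> times the weight
    \<open>(2 * r) ^ h\<close>. Its sum over \<open>h\<close> is a binomial expansion of
    \<open>(2 * r + r) ^ (m + n)\<close>.\<close>
  define u where "u = (\<lambda>h m. 2 * 2 ^ k / norm N ^ (m + n) * (real ((m + n) choose h) * r ^ (m + n - h)) * (2 * r) ^ h)"
  have N: "norm N > 0" "N \<noteq> 0" using r by auto
  have sN: "norm (s / N) < 1" using r N by (simp add: norm_divide divide_less_eq)
  have y: "3 * r / norm N \<le> 1 / 2" "0 \<le> 3 * r / norm N" using r N by (auto simp: field_simps)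
  have c_sums: "c h sums X h" for h
    unfolding c_def X_def using gbinomial_trinomial_revision_sums[OF sN] .
  have coeff_pow: "coeff ([:s, 1:] ^ m) h = of_nat (m choose h) * s ^ (m - h)" for h m
  proof (cases "h \<le> m")
    case False
    then show ?thesis by (simp add: binomial_eq_0 coeff_eq_0 degree_linear_power)
  qed (simp add: coeff_linear_poly_power)
  have coeffT: "coeff (pcompose T [:s, 1:]) h = (\<Sum>m<n. c h m)" for h
    unfolding T_def pcompose_sum coeff_sum c_def \<alpha>_def
    by (intro sum.cong refl)
       (simp add: monom_altdef pcompose_smult pcompose_power pcompose_pCons coeff_pow)
  have coeffP: "coeff ?P h = (4 * N) ^ k * (X h - (\<Sum>m<n. c h m))" if h: "h \<le> k" for h
  proof -
    have nz: "1 + s / N \<noteq> 0" using sN by (metis add.inverse_unique norm_minus_cancel norm_one order.irrefl)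
    have "(1 + s / N) powr (\<alpha> - of_nat h) = (1 + s / N) powr (of_nat (k - h) + 1 / 2)"
      using h by (simp add: \<alpha>_def of_nat_diff algebra_simps)
    also have "\<dots> = (1 + s / N) ^ (k - h) * (1 + s / N) powr (1 / 2)"
      using nz by (simp add: powr_add powr_nat')
    finally have "N ^ (k - h) * (1 + s / N) powr (\<alpha> - of_nat h) = (N * (1 + s / N)) ^ (k - h) * (1 + s / N) powr (1 / 2)"
      by (simp add: power_mult_distrib)
    also have "N * (1 + s / N) = N + s" using N by (simp add: algebra_simps)
    finally have *: "N ^ (k - h) * (1 + s / N) powr (\<alpha> - of_nat h) = (N + s) ^ (k - h) * (1 + s / N) powr (1 / 2)" .
    have "N ^ k = N ^ (k - h) * N ^ h" using h by (simp flip: power_add)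
    then have "(4 * N) ^ k * X h = 4 ^ k * (\<alpha> gchoose h) * (N ^ (k - h) * (1 + s / N) powr (\<alpha> - of_nat h))"
      using N by (simp add: X_def power_mult_distrib)
    then show ?thesis unfolding * using h
      by (simp add: coeff_half_power coeff_poly_cutoff coeffT right_diff_distrib \<alpha>_def mult_ac)
  qed
  have u_eq: "(\<Sum>h\<le>m + n. u h m) = 2 * 2 ^ k * (3 * r / norm N) ^ (m + n)" for m
  proof -
    have "(\<Sum>h\<le>m + n. u h m) = 2 * 2 ^ k / norm N ^ (m + n) * (\<Sum>h\<le>m + n. real ((m + n) choose h) * (2 * r) ^ h * r ^ (m + n - h))"
      unfolding u_def sum_distrib_left by (intro sum.cong refl) (simp add: mult_ac)
    also have "(\<Sum>h\<le>m + n. real ((m + n) choose h) * (2 * r) ^ h * r ^ (m + n - h)) = (2 * r + r) ^ (m + n)"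
      using binomial_ring[of "2 * r" r "m + n"] by simp
    finally show ?thesis by (simp add: power_divide)
  qed
  have u_nonneg: "u h m \<ge> 0" for h m using r by (simp add: u_def)
  have u_sum_le: "(\<Sum>h\<le>k. u h m) \<le> 2 * 2 ^ k * (3 * r / norm N) ^ (m + n)" for m
  proof -
    have "(\<Sum>h\<le>k. u h m) \<le> (\<Sum>h\<in>{..k} \<union> {..m + n}. u h m)"
      by (intro sum_mono2) (auto simp: u_nonneg)
    also have "\<dots> = (\<Sum>h\<le>m + n. u h m)"
      by (intro sum.mono_neutral_right) (auto simp: u_def binomial_eq_0)
    finally show ?thesis by (simp add: u_eq)
  qed
  have geom: "(\<lambda>m. 2 * 2 ^ k * (3 * r / norm N) ^ (m + n)) sums
      (2 * 2 ^ k * (3 * r / norm N) ^ n * (1 / (1 - 3 * r / norm N)))"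
    unfolding power_add
    by (subst (2) mult.commute, subst mult.assoc[symmetric]) (use y in \<open>intro sums_mult geometric_sums, auto\<close>)
  have u_summable: "summable (u h)" if "h \<le> k" for h
  proof (rule summable_comparison_test'[OF sums_summable[OF geom]])
    fix m assume "m \<ge> (0::nat)"
    have "u h m \<le> (\<Sum>h\<le>k. u h m)" using that by (intro member_le_sum) (auto simp: u_nonneg)
    then show "norm (u h m) \<le> 2 * 2 ^ k * (3 * r / norm N) ^ (m + n)" using u_sum_le[of m] u_nonneg[of h m] by simp
  qed
  have coeff_bound: "norm (coeff ?P h) * (2 * r) ^ h \<le> (4 * norm N) ^ k * (\<Sum>m. u h m)" if h: "h \<le> k" for h
  proof -
    have "(\<lambda>m. c h (m + n) * of_real ((2 * r) ^ h)) sums ((X h - (\<Sum>m<n. c h m)) * of_real ((2 * r) ^ h))"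
      by (intro sums_mult2 sums_split_initial_segment c_sums)
    moreover have "norm (c h (m + n) * of_real ((2 * r) ^ h)) \<le> u h m" for m
    proof -
      have "norm (\<alpha> gchoose (m + n)) \<le> 2 * 2 ^ k"
        using norm_gbinomial_half_le[of "Suc k" "m + n"] by (simp add: \<alpha>_def add.commute)
      then show ?thesis using r unfolding c_def u_def
        by (simp add: norm_mult norm_divide norm_power norm_of_real)
           (intro mult_mono mult_right_mono divide_right_mono mult_left_mono power_mono, auto)
    qed
    ultimately have "norm ((X h - (\<Sum>m<n. c h m)) * of_real ((2 * r) ^ h)) \<le> (\<Sum>m. u h m)"
      using norm_suminf_le[OF _ u_summable[OF h], of "\<lambda>m. c h (m + n) * of_real ((2 * r) ^ h)"]
      by (auto simp: sums_iff)
    then have "norm (X h - (\<Sum>m<n. c h m)) * (2 * r) ^ h \<le> (\<Sum>m. u h m)"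
      using r by (simp only: norm_mult norm_of_real) simp
    then have "(4 * norm N) ^ k * (norm (X h - (\<Sum>m<n. c h m)) * (2 * r) ^ h) \<le> (4 * norm N) ^ k * (\<Sum>m. u h m)"
      by (rule mult_left_mono) simp
    then show ?thesis unfolding coeffP[OF h] by (simp add: norm_mult norm_power mult.assoc)
  qed
  have "wnorm (2 * r) ?P \<le> (\<Sum>h\<le>k. norm (coeff ?P h) * (2 * r) ^ h)"
    using r by (intro wnorm_le_sum) (auto simp: coeff_half_power coeff_poly_cutoff)
  also have "\<dots> \<le> (\<Sum>h\<le>k. (4 * norm N) ^ k * (\<Sum>m. u h m))"
    by (intro sum_mono coeff_bound) auto
  also have "\<dots> = (4 * norm N) ^ k * (\<Sum>m. \<Sum>h\<le>k. u h m)"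
    by (subst suminf_sum) (auto simp: u_summable sum_distrib_left)
  also have "(\<Sum>m. \<Sum>h\<le>k. u h m) \<le> (\<Sum>m. 2 * 2 ^ k * (3 * r / norm N) ^ (m + n))"
    by (intro suminf_le u_sum_le sums_summable[OF geom] summable_sum) (auto simp: u_summable)
  also have "\<dots> = 2 * 2 ^ k * (3 * r / norm N) ^ n * (1 / (1 - 3 * r / norm N))"
    using geom by (simp add: sums_iff)
  also have "\<dots> \<le> 2 * 2 ^ k * (3 * r / norm N) ^ n * 2"
  proof (intro mult_left_mono mult_nonneg_nonneg zero_le_power y)
    have "1 / (1 - x) \<le> 2" if "x \<le> 1 / 2" for x :: real
      using that by (simp add: divide_le_eq)
    then show "1 / (1 - 3 * r / norm N) \<le> 2" using y by blast
  qed simp_all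
  finally have "wnorm (2 * r) ?P \<le> (4 * norm N) ^ k * (2 * 2 ^ k * (3 * r / norm N) ^ n * 2)"
    by (simp add: mult_left_mono)
  also have "\<dots> = 4 * ((4 * norm N) * 2) ^ k * (3 * r / norm N) ^ n"
    by (simp only: power_mult_distrib)
  finally show ?thesis by (simp add: mult.commute)
qed

text \<open>The interpolated data split into a partial sum \<open>gT\<close>, a series tail
  \<open>gR\<close> and the approximation error \<open>gE\<close>. The interpolant of
  \<open>gT\<close> has no coefficient at index \<open>degree I\<close>, so the leading coefficient
  of \<open>I\<close>, a nonzero element of \<open>R\<close>, is accounted for by the two small
  parts; they give the two terms of the bound.\<close>

theorem (in discrete_ring) simultaneous_approximation:
  fixes k :: nat and S :: "complex set" and N :: complex
  defines "\<theta> \<equiv> \<lambda>s. (1 + s / N) powr (1 / 2)"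
  assumes S: "finite S" "card S = 3" "S \<subseteq> R" and e: "\<And>s. s \<in> S \<Longrightarrow> e s \<in> R"
    and D: "\<And>s. s \<in> S \<Longrightarrow> e s * (\<Prod>t\<in>S - {s}. s - t) = D" and "D \<noteq> 0"
    and r: "r \<ge> 1" "\<And>s. s \<in> S \<Longrightarrow> norm s \<le> r" "\<And>s. s \<in> S \<Longrightarrow> norm (e s) \<le> 2 * r"
    and N: "N \<in> R" "6 * r \<le> norm N"
    and p: "\<And>s. s \<in> S \<Longrightarrow> p s \<in> R" and s0: "s0 \<in> S" "p s0 \<noteq> 0"
    and approx: "\<And>s. s \<in> S \<Longrightarrow> norm (p s - q * \<theta> s) \<le> \<epsilon>"
  shows "1 \<le> 96 * norm q * r ^ 3 * (2 ^ 18 * r ^ 6 / norm N ^ 2) ^ k + 48 * \<epsilon> * r ^ 3 * (2 ^ 14 * r ^ 3 * norm N) ^ k"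
proof -
  \<comment> \<open>The truncation order equals the lower bound \<open>card S * k\<close> for the
    degree of \<open>I\<close>, so \<open>T\<close> stays below the leading index of
    \<open>I\<close>.\<close>
  define n where "n = 3 * k"
  define T where "T = (\<Sum>m<n. monom ((of_nat k + 1 / 2 gchoose m) / N ^ m) m)"
  define gP where "gP = (\<lambda>s. smult (p s) (half_power k (N + s)))"
  define gT where "gT = (\<lambda>s. smult (q * (4 * N) ^ k) (poly_cutoff (Suc k) (pcompose T [:s, 1:])))"
  define gR where "gR = (\<lambda>s. smult q (smult (\<theta> s) (half_power k (N + s)) - smult ((4 * N) ^ k) (poly_cutoff (Suc k) (pcompose T [:s, 1:]))))"
  define gE where "gE = (\<lambda>s. smult (p s - q * \<theta> s) (half_power k (N + s)))"
  define I where "I = interp S e k gP"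
  have gP_eq: "gP = (\<lambda>s. gT s + (gR s + gE s))"
    by (auto simp: gP_def gT_def gR_def gE_def smult_diff_right smult_diff_left smult_add_left mult.assoc)
  have N_pos: "norm N > 0" using N r by linarith
  have Ns: "N + s \<noteq> 0" if "s \<in> S" for s
  proof
    assume "N + s = 0"
    then have "norm N = norm s" by (metis add_eq_0_iff norm_minus_cancel)
    then show False using N r(1) r(2)[OF that] by linarith
  qed
  have I: "card S * k \<le> degree I" "I \<noteq> 0"
    unfolding I_def gP_def using interp_half_power_degree[of S s0 p N D e k, OF S(1) s0 Ns[OF s0(1)] \<open>D \<noteq> 0\<close> D]
    by auto
  have "half_power k (N + s) \<in> polys" if "s \<in> S" for s
    using S(3) that N(1) by (intro half_power_polys discrete_ring_axioms add_mem) auto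
  then have "I \<in> polys"
    unfolding I_def gP_def using S e p by (intro interp_polys smult_polys) auto
  then have lead_ge: "norm (lead_coeff I) \<ge> 1"
    using I by (intro norm_ge_1) (auto dest: polysD)
  have T_deg: "degree T < n \<or> T = 0"
  proof (cases "n = 0")
    case False
    have "degree T \<le> n - 1" unfolding T_def
      by (intro degree_sum_le) (auto intro: order.trans[OF degree_monom_le])
    then show ?thesis using False by auto
  qed (simp add: T_def)
  \<comment> \<open>Uniqueness of Hermite interpolation: both sides have degree below
    \<open>card S * (k + 1)\<close> and agree to order \<open>k + 1\<close> at every node.\<close>
  have "interp S e k gT = smult (D ^ (2 * k + 1) * (q * (4 * N) ^ k)) T" (is "_ = ?T")
  proof (rule ccontr)
    assume ne: "interp S e k gT \<noteq> ?T"
    have "[:- s, 1:] ^ Suc k dvd interp S e k gT - ?T" if "s \<in> S" for s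
    proof -
      have "[[:q * (4 * N) ^ k:] * poly_cutoff (Suc k) (pcompose T [:s, 1:]) = [:q * (4 * N) ^ k:] * pcompose T [:s, 1:]] (mod monom 1 (Suc k))"
        by (intro cong_mult cong_refl poly_cutoff_cong)
      then have "[pcompose (gT s) [:- s, 1:] = pcompose (smult (q * (4 * N) ^ k) (pcompose T [:s, 1:])) [:- s, 1:]] (mod [:- s, 1:] ^ Suc k)"
        by (intro pcompose_cong) (simp add: gT_def)
      moreover have "pcompose (pcompose T [:s, 1:]) [:- s, 1:] = T"
        by (simp add: pcompose_pCons flip: pcompose_assoc)
      ultimately have "[[:D ^ (2 * k + 1):] * pcompose (gT s) [:- s, 1:] = [:D ^ (2 * k + 1):] * smult (q * (4 * N) ^ k) T] (mod [:- s, 1:] ^ Suc k)"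
        by (intro cong_mult cong_refl) (simp add: pcompose_smult)
      then have "[smult (D ^ (2 * k + 1)) (pcompose (gT s) [:- s, 1:]) = ?T] (mod [:- s, 1:] ^ Suc k)"
        by (simp add: mult_ac)
      with interp_cong[of S s e D k gT, OF S(1) that D[OF that]] have "[interp S e k gT = ?T] (mod [:- s, 1:] ^ Suc k)"
        by (rule cong_trans)
      then show ?thesis by (simp add: cong_iff_dvd_diff)
    qed
    then have "card S * Suc k \<le> degree (interp S e k gT - ?T)"
      using ne by (intro node_powers_dvd_imp_degree S) auto
    moreover have "degree (interp S e k gT - ?T) < card S * Suc k"
    proof (rule degree_diff_less)
      show "degree (interp S e k gT) < card S * Suc k"
        using degree_interp[OF S(1), of e k gT] S by auto
      show "degree ?T < card S * Suc k"
        using T_deg S by (intro le_less_trans[OF degree_smult_le]) (auto simp: n_def)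
    qed
    ultimately show False by simp
  qed
  then have "coeff (interp S e k gT) (degree I) = 0"
    using T_deg I S by (auto simp: n_def intro: coeff_eq_0)
  then have lead: "lead_coeff I = coeff (interp S e k (\<lambda>s. gR s + gE s)) (degree I)"
    unfolding I_def gP_eq by (simp add: interp_add)
  \<comment> \<open>The weight \<open>r ^ (3 * k)\<close> gained here cancels half of the factor
    \<open>(r ^ 6) ^ k\<close> from the interpolation bound.\<close>
  have "norm (lead_coeff I) * r ^ n \<le> norm (lead_coeff I) * r ^ degree I"
    using r I S by (intro mult_left_mono power_increasing) (auto simp: n_def)
  also have "\<dots> \<le> wnorm r (interp S e k (\<lambda>s. gR s + gE s))"
    unfolding lead using r by (intro coeff_le_wnorm) auto
  also have "\<dots> \<le> (2 * r) ^ (2 * k + 1) * (2 * r) ^ ((card S - 1) * Suc k) * (8 * r) ^ ((card S - 1) * k) *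
      (\<Sum>s\<in>S. wnorm (2 * r) (gR s + gE s))"
    using r by (intro wnorm_interp S) auto
  also have "(2 * r) ^ (2 * k + 1) * (2 * r) ^ ((card S - 1) * Suc k) * (8 * r) ^ ((card S - 1) * k)
      = 8 * (2 ^ 10) ^ k * r ^ 3 * (r ^ 6) ^ k"
  proof -
    have "(2 * r) ^ (2 * k + 1) * (2 * r) ^ ((card S - 1) * Suc k) * (8 * r) ^ ((card S - 1) * k) =
       ((2 * r) ^ 2 * (2 * r) ^ 2 * (8 * r) ^ 2) ^ k * ((2 * r) * (2 * r) ^ 2)"
      by (simp only: S power_mult power_mult_distrib power_add power_Suc)
         (simp add: power_mult[symmetric] mult.commute[of k] power_add power2_eq_square)
    also have "(2 * r) ^ 2 * (2 * r) ^ 2 * (8 * r) ^ 2 = 2 ^ 10 * r ^ 6" by (simp add: power_mult_distrib eval_nat_numeral)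
    also have "(2 * r) * (2 * r) ^ 2 = 8 * r ^ 3" by (simp add: eval_nat_numeral)
    finally show ?thesis by (simp add: power_mult_distrib)
  qed
  finally have lead_le: "norm (lead_coeff I) * r ^ n \<le> 8 * (2 ^ 10) ^ k * r ^ 3 * (r ^ 6) ^ k *
      (\<Sum>s\<in>S. wnorm (2 * r) (gR s + gE s))" .
  have "(\<Sum>s\<in>S. wnorm (2 * r) (gR s + gE s)) \<le>
      (\<Sum>s\<in>S. norm q * (4 * (8 * norm N) ^ k * (3 * r / norm N) ^ n) + \<epsilon> * (2 * 16 ^ k * norm N ^ k))"
  proof (rule sum_mono)
    fix s assume s: "s \<in> S"
    have "wnorm (2 * r) (gR s) \<le> norm q * (4 * (8 * norm N) ^ k * (3 * r / norm N) ^ n)"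
      unfolding gR_def wnorm_smult \<theta>_def T_def using r s N
      by (intro mult_left_mono half_power_tail) auto
    moreover have "wnorm (2 * r) (gE s) \<le> \<epsilon> * (2 * 16 ^ k * norm N ^ k)"
    proof -
      have "wnorm (2 * r) (gE s) \<le> \<epsilon> * (2 * 8 ^ k * (norm (N + s) + 2 * r) ^ k)"
        unfolding gE_def wnorm_smult using approx[OF s] r order.trans[OF norm_ge_zero approx[OF s]]
        by (intro mult_mono wnorm_half_power) auto
      also have "\<dots> \<le> \<epsilon> * (2 * 8 ^ k * (2 * norm N) ^ k)"
      proof -
        have "norm (N + s) + 2 * r \<le> 2 * norm N"
          using norm_triangle_ineq[of N s] r(1) r(2)[OF s] N by linarith
        moreover have "\<epsilon> \<ge> 0" by (rule order.trans[OF norm_ge_zero approx[OF s]])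
        ultimately show ?thesis using r by (intro mult_left_mono power_mono) auto
      qed
      also have "2 * 8 ^ k * (2 * norm N) ^ k = 2 * 16 ^ k * norm N ^ k"
      proof -
        have "(16 :: real) ^ k = 8 ^ k * 2 ^ k" by (simp flip: power_mult_distrib)
        then show ?thesis by (simp only: power_mult_distrib mult.assoc)
      qed
      finally show ?thesis .
    qed
    ultimately show "wnorm (2 * r) (gR s + gE s) \<le>
        norm q * (4 * (8 * norm N) ^ k * (3 * r / norm N) ^ n) + \<epsilon> * (2 * 16 ^ k * norm N ^ k)"
      using wnorm_add[of "2 * r" "gR s" "gE s"] r by linarith
  qed
  also have "\<dots> = 12 * norm q * (8 * norm N * (3 * r / norm N) ^ 3) ^ k + 6 * \<epsilon> * (16 * norm N) ^ k"
  proof -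
    have *: "3 * (x * (4 * a * b) + \<epsilon> * (2 * c * d)) = 12 * x * (a * b) + 6 * \<epsilon> * (c * d)" for x a b c d :: real
      by (simp add: algebra_simps)
    show ?thesis
      using *[of "norm q" "(8 * norm N) ^ k" "((3 * r / norm N) ^ 3) ^ k" "16 ^ k" "norm N ^ k"]
      by (simp only: S sum_constant n_def power_mult power_mult_distrib[of _ "(3 * r / norm N) ^ 3"]
          power_mult_distrib[of 16] of_nat_numeral)
  qed
  finally have "8 * (2 ^ 10) ^ k * r ^ 3 * (r ^ 6) ^ k * (\<Sum>s\<in>S. wnorm (2 * r) (gR s + gE s)) \<le>
      8 * (2 ^ 10) ^ k * r ^ 3 * (r ^ 6) ^ k *
      (12 * norm q * (8 * norm N * (3 * r / norm N) ^ 3) ^ k + 6 * \<epsilon> * (16 * norm N) ^ k)"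
    by (rule mult_left_mono) (use r in simp)
  moreover have "1 * r ^ n \<le> norm (lead_coeff I) * r ^ n"
    using r lead_ge by (intro mult_right_mono) auto
  ultimately have "r ^ n \<le> 8 * (2 ^ 10) ^ k * r ^ 3 * (r ^ 6) ^ k *
      (12 * norm q * (8 * norm N * (3 * r / norm N) ^ 3) ^ k + 6 * \<epsilon> * (16 * norm N) ^ k)"
    using lead_le by linarith
  also have "\<dots> = r ^ n * (96 * norm q * r ^ 3 * (2 ^ 10 * r ^ 3 * (8 * norm N * (3 * r / norm N) ^ 3)) ^ k +
      48 * \<epsilon> * r ^ 3 * (2 ^ 14 * r ^ 3 * norm N) ^ k)"
  proof -
    have r6: "(r ^ 6) ^ k = r ^ n * (r ^ 3) ^ k"
    proof -
      have "r ^ 6 = r ^ 3 * r ^ 3" by (simp flip: power_add)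
      then show ?thesis by (simp only: n_def power_mult power_mult_distrib)
    qed
    have p14: "(2 ^ 14 * r ^ 3 * norm N) ^ k = (2 ^ 10) ^ k * (r ^ 3) ^ k * (16 * norm N) ^ k"
      by (simp only: power_mult_distrib[symmetric] mult_ac) simp
    have *: "8 * a * x * (y * b) * (12 * u * c + 6 * \<epsilon> * d) = y * (96 * u * x * (a * b * c) + 48 * \<epsilon> * x * (a * b * d))"
      for a b c d u x y :: real by (simp add: algebra_simps)
    show ?thesis unfolding r6 p14 power_mult_distrib[of "2 ^ 10 * r ^ 3"] power_mult_distrib[of "2 ^ 10"]
      by (rule *)
  qed
  finally have main: "1 \<le> 96 * norm q * r ^ 3 * (2 ^ 10 * r ^ 3 * (8 * norm N * (3 * r / norm N) ^ 3)) ^ k +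
      48 * \<epsilon> * r ^ 3 * (2 ^ 14 * r ^ 3 * norm N) ^ k"
    using r by (simp add: mult_le_cancel_left1)
  have "2 ^ 10 * r ^ 3 * (8 * norm N * (3 * r / norm N) ^ 3) = 221184 * r ^ 6 / norm N ^ 2"
    using N_pos by (simp add: power_divide power_mult_distrib eval_nat_numeral field_simps)
  also have "\<dots> \<le> 2 ^ 18 * r ^ 6 / norm N ^ 2" using r by (intro divide_right_mono mult_right_mono) auto
  finally have "(2 ^ 10 * r ^ 3 * (8 * norm N * (3 * r / norm N) ^ 3)) ^ k \<le> (2 ^ 18 * r ^ 6 / norm N ^ 2) ^ k"
    using r by (intro power_mono) auto
  then have "96 * norm q * r ^ 3 * (2 ^ 10 * r ^ 3 * (8 * norm N * (3 * r / norm N) ^ 3)) ^ k \<le>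
      96 * norm q * r ^ 3 * (2 ^ 18 * r ^ 6 / norm N ^ 2) ^ k"
    using r by (intro mult_left_mono) auto
  with main show ?thesis by linarith
qed

subsection \<open>Approximations coming from a quadruple\<close>

text \<open>The difference of the squares of \<open>v * t * y\<close> and
  \<open>v * u * z * \<theta>\<close> equals \<open>v ^ 2 * \<theta> ^ 2 * u * (c - u)\<close>, in
  which \<open>d\<close> cancels. Dividing by the larger of their sum and difference leaves the
  other one small. The factor \<open>v\<close> lets two applications share one denominator.\<close>

lemma sqrt_approximation:
  fixes u v c d t y z \<theta> :: complex
  assumes t: "u * c + 1 = t ^ 2" and y: "u * d + 1 = y ^ 2" and z: "c * d + 1 = z ^ 2"
    and \<theta>: "\<theta> ^ 2 = 1 + 1 / (u * c)"
    and u: "1 \<le> norm u" "norm u \<le> norm c" and "z \<noteq> 0" "v \<noteq> 0"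
  obtains \<sigma> where "\<sigma> = 1 \<or> \<sigma> = -1" "norm (\<sigma> * (v * t * y) - v * u * z * \<theta>) \<le> 4 * norm v * norm c / norm z"
proof -
  define V where "V = v * u * z * \<theta>"
  define Q where "Q = v * t * y"
  have nz: "u \<noteq> 0" "c \<noteq> 0" using u by auto
  \<comment> \<open>There is no preferred complex square root, so the sign is chosen to keep
    \<open>\<sigma> * Q + V\<close> away from zero.\<close>
  have "norm (2 * V) \<le> norm (Q + V) + norm (- Q + V)"
    using norm_triangle_ineq[of "Q + V" "- Q + V"] by simp
  then have "norm V \<le> norm (Q + V) \<or> norm V \<le> norm (- Q + V)"
    unfolding norm_mult by auto
  then obtain \<sigma> where \<sigma>: "\<sigma> = 1 \<or> \<sigma> = -1" and le: "norm V \<le> norm (\<sigma> * Q + V)"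
    by (metis mult_1 mult_minus1)
  have \<theta>t: "\<theta> ^ 2 * (u * c) = t ^ 2" using nz by (simp add: \<theta> t[symmetric] field_simps)
  have "c * ((\<sigma> * Q - V) * (\<sigma> * Q + V)) = c * Q ^ 2 - c * V ^ 2"
    using \<sigma> by (auto simp: power2_eq_square algebra_simps)
  also have "\<dots> = v ^ 2 * (c * t ^ 2 * y ^ 2 - u * (\<theta> ^ 2 * (u * c)) * z ^ 2)"
    by (simp add: Q_def V_def power_mult_distrib algebra_simps power2_eq_square)
  also have "\<dots> = v ^ 2 * t ^ 2 * (c * y ^ 2 - u * z ^ 2)"
    unfolding \<theta>t by (simp add: algebra_simps)
  also have "c * y ^ 2 - u * z ^ 2 = c - u" by (simp add: y[symmetric] z[symmetric] algebra_simps)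
  also have "v ^ 2 * t ^ 2 * (c - u) = v ^ 2 * \<theta> ^ 2 * u * c * (c - u)" by (simp add: \<theta>t[symmetric])
  also have "\<dots> = c * (v ^ 2 * \<theta> ^ 2 * u * (c - u))" by (simp only: ac_simps)
  finally have "(\<sigma> * Q - V) * (\<sigma> * Q + V) = v ^ 2 * \<theta> ^ 2 * u * (c - u)"
    by (rule mult_left_cancel[OF nz(2), THEN iffD1])
  from arg_cong[OF this, of norm]
  have eq: "norm (\<sigma> * Q - V) * norm (\<sigma> * Q + V) = norm v ^ 2 * norm \<theta> ^ 2 * norm u * norm (c - u)"
    by (simp only: norm_mult norm_power)
  have cu: "norm (c - u) \<le> 2 * norm c" using norm_triangle_ineq4[of c u] u by linarith
  have "norm (\<sigma> * Q - V) * norm V \<le> norm (\<sigma> * Q - V) * norm (\<sigma> * Q + V)"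
    by (intro mult_left_mono le) simp
  also have "\<dots> \<le> norm v ^ 2 * norm \<theta> ^ 2 * norm u * (2 * norm c)"
    unfolding eq by (intro mult_left_mono cu) simp
  also have "\<dots> = (norm v * norm u * norm \<theta>) * (2 * norm v * norm \<theta> * norm c)"
    by (simp add: power2_eq_square)
  also have "norm (\<sigma> * Q - V) * norm V = (norm v * norm u * norm \<theta>) * (norm (\<sigma> * Q - V) * norm z)"
    by (simp only: V_def norm_mult ac_simps)
  finally have scaled: "(norm v * norm u * norm \<theta>) * (norm (\<sigma> * Q - V) * norm z) \<le>
      (norm v * norm u * norm \<theta>) * (2 * norm v * norm \<theta> * norm c)" .
  have "1 \<le> norm u * norm c"
    using mult_mono[of 1 "norm u" 1 "norm c"] u by linarith
  have "norm \<theta> ^ 2 \<le> 2 ^ 2"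
  proof -
    have "norm \<theta> ^ 2 = norm (1 + 1 / (u * c))" by (simp add: \<theta> flip: norm_power)
    also have "\<dots> \<le> 1 + 1 / (norm u * norm c)"
      using norm_triangle_ineq[of 1 "1 / (u * c)"] by (simp add: norm_divide norm_mult)
    also have "\<dots> \<le> 1 + 1" using \<open>1 \<le> norm u * norm c\<close> by simp
    finally show ?thesis by simp
  qed
  then have \<theta>2: "norm \<theta> \<le> 2" by (rule power2_le_imp_le) simp
  show ?thesis
  proof (cases "\<theta> = 0")
    case True
    then have "t = 0" using \<theta>t by simp
    then show ?thesis using that[of 1] True by simp
  next
    case False
    then have "norm v * norm u * norm \<theta> > 0" using nz \<open>v \<noteq> 0\<close> by simp
    with scaled have "norm (\<sigma> * Q - V) * norm z \<le> 2 * norm v * norm \<theta> * norm c"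
      by (simp only: mult_le_cancel_left_pos)
    also have "\<dots> \<le> 2 * norm v * 2 * norm c"
      using \<theta>2 by (intro mult_right_mono mult_left_mono) auto
    finally have "norm (\<sigma> * Q - V) \<le> 4 * norm v * norm c / norm z"
      using \<open>z \<noteq> 0\<close> by (simp add: field_simps)
    then show ?thesis using that[of \<sigma>] \<sigma> by (simp add: Q_def V_def)
  qed
qed

text \<open>At \<open>a\<close> and \<open>b\<close> the squares of the approximated roots are
  \<open>1 + 1 / (b * c)\<close> and \<open>1 + 1 / (a * c)\<close>; the common denominator is
  \<open>a * b * z\<close>, and the value at node 0 is exact.\<close>

lemma (in discrete_ring) quadruple_approximation:
  assumes R: "a \<in> R" "b \<in> R" "c \<in> R" "s \<in> R" "t \<in> R" "x \<in> R" "y \<in> R" "z \<in> R"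
    and sq: "a * c + 1 = s ^ 2" "b * c + 1 = t ^ 2" "a * d + 1 = x ^ 2" "b * d + 1 = y ^ 2" "c * d + 1 = z ^ 2"
    and "a \<noteq> b" "z \<noteq> 0" and ab: "1 \<le> norm a" "norm a \<le> norm b" "norm b \<le> norm c"
    and N: "6 * norm b \<le> norm (a * b * c)"
  shows "1 \<le> 96 * norm b ^ 5 * norm z * (2 ^ 18 * norm b ^ 6 / norm (a * b * c) ^ 2) ^ k +
    192 * norm b ^ 4 * norm c / norm z * (2 ^ 14 * norm b ^ 3 * norm (a * b * c)) ^ k"
proof -
  define N where "N = a * b * c"
  define \<theta> where "\<theta> = (\<lambda>s. (1 + s / N) powr (1 / 2))"
  have nz: "a \<noteq> 0" "b \<noteq> 0" "c \<noteq> 0" using ab by auto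
  have \<theta>2: "\<theta> s ^ 2 = 1 + s / N" for s
    by (cases "1 + s / N = 0") (simp_all add: \<theta>_def power2_eq_square flip: powr_add)
  have \<theta>a: "\<theta> a ^ 2 = 1 + 1 / (b * c)" and \<theta>b: "\<theta> b ^ 2 = 1 + 1 / (a * c)"
    using nz by (simp_all add: \<theta>2 N_def)
  obtain \<sigma> where \<sigma>: "\<sigma> = 1 \<or> \<sigma> = -1"
    "norm (\<sigma> * (a * t * y) - a * b * z * \<theta> a) \<le> 4 * norm a * norm c / norm z"
    using sqrt_approximation[OF sq(2,4,5) \<theta>a _ ab(3) \<open>z \<noteq> 0\<close> nz(1)] ab by (metis order.trans)
  obtain \<tau> where \<tau>: "\<tau> = 1 \<or> \<tau> = -1"
    "norm (\<tau> * (b * s * x) - b * a * z * \<theta> b) \<le> 4 * norm b * norm c / norm z"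
    using sqrt_approximation[OF sq(1,3,5) \<theta>b ab(1) _ \<open>z \<noteq> 0\<close> nz(2)] ab by (metis order.trans)
  define p where "p = (\<lambda>u. if u = 0 then a * b * z else if u = a then \<sigma> * (a * t * y) else \<tau> * (b * s * x))"
  \<comment> \<open>Up to sign, the difference of the two other nodes; hence \<open>D\<close> is the
    Vandermonde product while the weights have size at most \<open>2 * norm b\<close>.\<close>
  define e where "e = (\<lambda>u. if u = 0 then b - a else if u = a then - b else a)"
  have signs: "\<sigma> \<in> R" "\<tau> \<in> R" using \<sigma>(1) \<tau>(1) one_mem uminus_mem by auto
  have "1 \<le> 96 * norm (a * b * z) * norm b ^ 3 * (2 ^ 18 * norm b ^ 6 / norm N ^ 2) ^ k +
      48 * (4 * norm b * norm c / norm z) * norm b ^ 3 * (2 ^ 14 * norm b ^ 3 * norm N) ^ k"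
  proof (rule simultaneous_approximation[of "{0, a, b}" e "a * b * (b - a)"])
    show "card {0, a, b} = 3" using nz \<open>a \<noteq> b\<close> by simp
    show "e u * (\<Prod>t\<in>{0, a, b} - {u}. u - t) = a * b * (b - a)" if u: "u \<in> {0, a, b}" for u
    proof -
      have "{0, a, b} - {0} = {a, b}" "{0, a, b} - {a} = {0, b}" "{0, a, b} - {b} = {0, a}"
        using nz \<open>a \<noteq> b\<close> by auto
      then have "e 0 * (\<Prod>t\<in>{0, a, b} - {0}. 0 - t) = (b - a) * ((0 - a) * (0 - b))"
        "e a * (\<Prod>t\<in>{0, a, b} - {a}. a - t) = - b * ((a - 0) * (a - b))"
        "e b * (\<Prod>t\<in>{0, a, b} - {b}. b - t) = a * ((b - 0) * (b - a))"
        using nz \<open>a \<noteq> b\<close> by (simp_all only: e_def) simp_all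
      moreover have "(b - a) * ((0 - a) * (0 - b)) = a * b * (b - a)"
        "- b * ((a - 0) * (a - b)) = a * b * (b - a)" "a * ((b - 0) * (b - a)) = a * b * (b - a)"
        by (simp_all add: algebra_simps)
      ultimately show ?thesis using u by (metis empty_iff insert_iff)
    qed
    show "norm (e u) \<le> 2 * norm b" if "u \<in> {0, a, b}" for u
      using that ab norm_triangle_ineq4[of b a] by (auto simp: e_def)
    show "norm (p u - a * b * z * (1 + u / N) powr (1 / 2)) \<le> 4 * norm b * norm c / norm z" if "u \<in> {0, a, b}" for u
    proof -
      have "4 * norm a * norm c / norm z \<le> 4 * norm b * norm c / norm z"
        using ab by (intro divide_right_mono mult_right_mono mult_left_mono) auto
      then show ?thesis
        using that \<sigma>(2) \<tau>(2) nz \<open>a \<noteq> b\<close> by (auto simp: p_def \<theta>_def mult.commute[of b a])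
    qed
    show "e u \<in> R" if "u \<in> {0, a, b}" for u using that R by (auto simp: e_def intro: diff_mem uminus_mem)
    show "p u \<in> R" if "u \<in> {0, a, b}" for u
      using R signs by (auto simp: p_def intro!: mult_mem)
    show "N \<in> R" using R by (auto simp: N_def intro!: mult_mem)
    show "p 0 \<noteq> 0" using nz \<open>z \<noteq> 0\<close> by (simp add: p_def)
    show "{0, a, b} \<subseteq> R" using R zero_mem by auto
  qed (use ab nz \<open>a \<noteq> b\<close> N in \<open>auto simp: N_def\<close>)
  also have "96 * norm (a * b * z) * norm b ^ 3 * (2 ^ 18 * norm b ^ 6 / norm N ^ 2) ^ k \<le>
      96 * norm b ^ 5 * norm z * (2 ^ 18 * norm b ^ 6 / norm N ^ 2) ^ k"
  proof -
    have "norm a * (norm b ^ 4 * norm z) \<le> norm b * (norm b ^ 4 * norm z)"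
      using ab by (intro mult_right_mono) auto
    then have "96 * norm (a * b * z) * norm b ^ 3 \<le> 96 * norm b ^ 5 * norm z"
      by (simp add: norm_mult eval_nat_numeral mult_ac)
    then show ?thesis by (rule mult_right_mono) simp
  qed
  also have "48 * (4 * norm b * norm c / norm z) * norm b ^ 3 = 192 * norm b ^ 4 * norm c / norm z"
    by (simp add: eval_nat_numeral)
  finally show ?thesis unfolding N_def by simp
qed

text \<open>Take the least \<open>k\<close> at which the tail term is below 1/2. The error term then
  bounds \<open>Z\<close> by a multiple of \<open>Q ^ k\<close>, so a large \<open>Z\<close> forces
  \<open>k > 5\<close>. Minimality at \<open>k - 1\<close> also bounds \<open>Z\<close> from below,
  and the two bounds together contradict the assumption on \<open>N\<close>.\<close>

lemma (in discrete_ring) quadruple_bound: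
  assumes R: "a \<in> R" "b \<in> R" "c \<in> R" "s \<in> R" "t \<in> R" "x \<in> R" "y \<in> R" "z \<in> R"
    and sq: "a * c + 1 = s ^ 2" "b * c + 1 = t ^ 2" "a * d + 1 = x ^ 2" "b * d + 1 = y ^ 2" "c * d + 1 = z ^ 2"
    and "a \<noteq> b" and ab: "1 \<le> norm a" "norm a \<le> norm b" "norm b \<le> norm c"
    and N: "2 ^ 64 * norm b ^ 19 \<le> norm (a * b * c)"
  shows "norm z < 384 * norm b ^ 4 * norm c * (2 ^ 14 * norm b ^ 3 * norm (a * b * c)) ^ 5"
proof (rule ccontr)
  define B where "B = norm b"
  define C where "C = norm c"
  define Z where "Z = norm z"
  define N where "N = norm (a * b * c)"
  define Q where "Q = 2 ^ 14 * B ^ 3 * N"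
  define E where "E = 2 ^ 18 * B ^ 6 / N ^ 2"
  assume "\<not> ?thesis"
  then have Z: "384 * B ^ 4 * C * Q ^ 5 \<le> Z" by (simp add: B_def C_def Z_def N_def Q_def)
  have B: "1 \<le> B" "B \<le> C" using ab by (auto simp: B_def C_def)
  have N_ge: "2 ^ 64 * B ^ 19 \<le> N" using assms(18) by (simp add: B_def N_def)
  have "C \<le> N"
  proof -
    have "1 * 1 \<le> norm a * norm b" using ab by (intro mult_mono) auto
    then have "1 * C \<le> (norm a * norm b) * C" using B by (intro mult_right_mono) auto
    then show ?thesis by (simp add: N_def C_def norm_mult)
  qed
  have N_pos: "N > 0" and Q_pos: "Q > 0" and E_pos: "E > 0"
    using B \<open>C \<le> N\<close> by (auto simp: Q_def E_def)
  have B_pow: "1 \<le> B ^ n" for n using B by simp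
  have QE: "Q * E = 2 ^ 32 * B ^ 9 / N"
    using N_pos by (simp add: Q_def E_def eval_nat_numeral field_simps)
  have "2 ^ 32 * B ^ 9 \<le> N"
  proof -
    have "2 ^ 32 * B ^ 9 \<le> 2 ^ 64 * B ^ 19"
      using B by (intro mult_mono power_increasing) auto
    with N_ge show ?thesis by linarith
  qed
  then have QE1: "Q * E \<le> 1" using N_pos by (simp add: QE)
  have Q1: "1 \<le> Q"
    unfolding Q_def using mult_mono[of 1 "2 ^ 14 * B ^ 3" 1 N] mult_mono[of 1 "2 ^ 14" 1 "B ^ 3"] B_pow[of 3] B \<open>C \<le> N\<close>
    by simp
  have "0 < 384 * B ^ 4 * C * Q ^ 5"
    using B Q_pos by (intro mult_pos_pos zero_less_power) auto
  with Z have "Z > 0" by linarith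
  then have "z \<noteq> 0" by (auto simp: Z_def)
  have "E < 1"
  proof -
    have "2 ^ 18 * B ^ 6 < 2 ^ 64 * B ^ 19"
      using B by (intro mult_less_le_imp_less power_increasing) auto
    also note N_ge
    also have "N \<le> N ^ 2" using B \<open>C \<le> N\<close> by (simp add: power2_eq_square)
    finally show ?thesis using N_pos by (simp add: E_def)
  qed
  define P where "P = (\<lambda>k. 192 * B ^ 5 * Z * E ^ k < 1)"
  have BZ_pos: "0 < 192 * B ^ 5 * Z" using B \<open>Z > 0\<close> by simp
  then obtain k' where "E ^ k' < 1 / (192 * B ^ 5 * Z)"
    using real_arch_pow_inv[OF _ \<open>E < 1\<close>] by (metis zero_less_divide_1_iff)
  then have "P k'" using BZ_pos by (simp add: P_def pos_less_divide_eq mult.commute)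
  then have exP: "\<exists>k. P k" by blast
  define k where "k = (LEAST k. P k)"
  have "P k" unfolding k_def using exP by (rule LeastI_ex)
  have "6 * B \<le> N"
  proof -
    have "6 * B \<le> 2 ^ 64 * B ^ 19"
      using B power_increasing[of 1 19 B] by (intro mult_mono) auto
    with N_ge show ?thesis by linarith
  qed
  then have "1 \<le> 96 * B ^ 5 * Z * E ^ k + 192 * B ^ 4 * C / Z * Q ^ k"
    using quadruple_approximation[OF R sq \<open>a \<noteq> b\<close> \<open>z \<noteq> 0\<close> ab, of k]
    by (simp add: B_def C_def Z_def N_def Q_def E_def)
  with \<open>P k\<close> have "1 / 2 < 192 * B ^ 4 * C / Z * Q ^ k" by (simp add: P_def)
  then have Zlt: "Z < 384 * B ^ 4 * C * Q ^ k" using \<open>Z > 0\<close> by (simp add: field_simps)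
  have "\<not> k \<le> 5"
  proof
    assume "k \<le> 5"
    then have "384 * B ^ 4 * C * Q ^ k \<le> 384 * B ^ 4 * C * Q ^ 5"
      using Q1 B by (intro mult_left_mono power_increasing) auto
    with Z Zlt show False by linarith
  qed
  then obtain j where j: "k = Suc j" "5 \<le> j" by (cases k) auto
  have "\<not> P j" using not_less_Least[of j P] by (simp add: k_def[symmetric] j)
  then have "1 \<le> 192 * B ^ 5 * Z * E ^ j" by (simp add: P_def)
  also have "\<dots> \<le> 192 * B ^ 5 * (384 * B ^ 4 * C * Q ^ k) * E ^ j"
    using Zlt B E_pos by (intro mult_right_mono mult_left_mono) auto
  also have "\<dots> = 73728 * B ^ 9 * C * Q * (Q * E) ^ j"
    by (simp add: j power_mult_distrib eval_nat_numeral)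
  also have "\<dots> \<le> 73728 * B ^ 9 * N * Q * (Q * E) ^ 5"
  proof (rule mult_mono)
    show "73728 * B ^ 9 * C * Q \<le> 73728 * B ^ 9 * N * Q"
      using B Q_pos \<open>C \<le> N\<close> by (intro mult_right_mono mult_left_mono) auto
    show "(Q * E) ^ j \<le> (Q * E) ^ 5" using QE1 Q_pos E_pos j by (intro power_decreasing) auto
  qed (use B N_pos Q_pos E_pos in auto)
  also have "\<dots> = 73728 * 2 ^ 174 * B ^ 57 / N ^ 3"
  proof -
    have "(Q * E) ^ 5 = 2 ^ 160 * B ^ 45 / N ^ 5"
      unfolding QE by (simp only: power_divide power_mult_distrib power_mult[symmetric]) simp
    moreover have "B ^ 57 = B ^ 9 * B ^ 3 * B ^ 45" by (simp flip: power_add)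
    moreover have "N ^ 5 = N ^ 3 * N * N" by (simp flip: power_Suc2)
    moreover have "73728 * X * N * (2 ^ 14 * Y * N) * (2 ^ 160 * W / (N ^ 3 * N * N)) =
        73728 * 2 ^ 174 * (X * Y * W) / N ^ 3" for X Y W
      using N_pos by (simp add: field_simps)
    ultimately show ?thesis by (simp only: Q_def)
  qed
  finally have "N ^ 3 \<le> 73728 * 2 ^ 174 * B ^ 57"
    using N_pos by (simp add: field_simps)
  \<comment> \<open>\<open>73728 = 192 * 384 < 2 ^ 18\<close>. The cube root of the resulting bound
    is exactly the threshold \<open>2 ^ 64 * B ^ 19\<close>.\<close>
  also have "\<dots> < 2 ^ 192 * B ^ 57" using B by (intro mult_strict_right_mono) auto
  also have "\<dots> = (2 ^ 64 * B ^ 19) ^ 3" by (simp add: power_mult_distrib flip: power_mult)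
  also have "\<dots> \<le> N ^ 3" using N_ge B by (intro power_mono) auto
  finally show False by simp
qed

subsection \<open>Gaps between the elements of a tuple\<close>

text \<open>The quantity \<open>(a + b + c + 2 * a * b * c)\<^sup>2 - 4 * r\<^sup>2 * s\<^sup>2 * t\<^sup>2\<close> equals the left-hand side of the
  assumption \<open>nonreg\<close>, whose vanishing characterises the triples with \<open>c = a + b \<plusminus> 2 * r\<close>.\<close>

lemma (in discrete_ring) triple_gap:
  assumes R: "a \<in> R" "b \<in> R" "c \<in> R" "r \<in> R" "s \<in> R" "t \<in> R"
    and sq: "a * b + 1 = r ^ 2" "a * c + 1 = s ^ 2" "b * c + 1 = t ^ 2"
    and nonreg: "(c - a - b) ^ 2 - 4 * (a * b + 1) \<noteq> 0"
    and le: "3 \<le> norm a" "norm a \<le> norm b" "norm b \<le> norm c"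
  shows "2 * norm a * norm b \<le> norm c"
proof (rule ccontr)
  assume not: "\<not> ?thesis"
  define A where "A = norm a"
  define B where "B = norm b"
  define C where "C = norm c"
  note norms = A_def[symmetric] B_def[symmetric] C_def[symmetric]
  have less: "C < 2 * A * B" using not by (simp add: norms)
  have AB: "3 \<le> A" "A \<le> B" "B \<le> C" using le by (simp_all add: norms)
  define u where "u = a + b + c + 2 * (a * b * c) + 2 * (r * s * t)"
  define v where "v = a + b + c + 2 * (a * b * c) - 2 * (r * s * t)"
  have "u * v = (a + b + c + 2 * (a * b * c)) ^ 2 - 4 * (r ^ 2 * s ^ 2 * t ^ 2)"
    by (simp add: u_def v_def power2_eq_square algebra_simps)
  also have "\<dots> = (c - a - b) ^ 2 - 4 * (a * b + 1)"
    unfolding sq[symmetric] by (simp add: power2_eq_square algebra_simps)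
  finally have uv: "u * v = (c - a - b) ^ 2 - 4 * (a * b + 1)" .
  then have "u \<noteq> 0" "v \<noteq> 0" using nonreg by auto
  moreover have "u \<in> R" "v \<in> R"
    unfolding u_def v_def using R by (auto intro!: add_mem diff_mem mult_mem numeral_mem)
  ultimately have "1 \<le> norm u" "1 \<le> norm v" by (auto intro: norm_ge_1)
  \<comment> \<open>Two factors of absolute value at least 1 have a sum at most 1 above their
    product. Here \<open>u * v\<close> is only quadratic in the elements, while \<open>u + v\<close>
    contains the cubic term \<open>4 * a * b * c\<close>.\<close>
  then have "0 \<le> (norm u - 1) * (norm v - 1)" by simp
  then have "norm u + norm v \<le> 1 + norm (u * v)" by (simp add: norm_mult algebra_simps)
  moreover have "norm (u * v) \<le> (A + B + C) ^ 2 + 4"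
  proof -
    have "u * v = (a ^ 2 + b ^ 2 + c ^ 2) - 2 * (a * b + a * c + b * c) - 4"
      unfolding uv by (simp add: power2_eq_square algebra_simps)
    also have "norm \<dots> \<le> norm (a ^ 2 + b ^ 2 + c ^ 2) + norm (2 * (a * b + a * c + b * c)) + norm (4 :: complex)"
      by (intro order.trans[OF norm_triangle_ineq4] add_right_mono norm_triangle_ineq4)
    also have "norm (a ^ 2 + b ^ 2 + c ^ 2) \<le> A ^ 2 + B ^ 2 + C ^ 2"
      unfolding A_def B_def C_def norm_power[symmetric]
      by (intro order.trans[OF norm_triangle_ineq] add_right_mono norm_triangle_ineq)
    also have "norm (2 * (a * b + a * c + b * c)) \<le> 2 * (A * B + A * C + B * C)"
    proof -
      have "norm (a * b + a * c + b * c) \<le> A * B + A * C + B * C"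
        unfolding A_def B_def C_def norm_mult[symmetric]
        by (intro order.trans[OF norm_triangle_ineq] add_right_mono norm_triangle_ineq)
      then have "2 * norm (a * b + a * c + b * c) \<le> 2 * (A * B + A * C + B * C)" by simp
      then show ?thesis by (subst norm_mult) (simp only: norm_numeral)
    qed
    finally show ?thesis by (simp add: power2_eq_square algebra_simps)
  qed
  moreover have "4 * (A * B * C) - 2 * (A + B + C) \<le> norm u + norm v"
  proof -
    have "4 * (A * B * C) = norm (u + v - 2 * (a + b + c))"
      by (simp add: u_def v_def A_def B_def C_def norm_mult)
    also have "\<dots> \<le> norm u + norm v + norm (2 * (a + b + c))"
      by (intro order.trans[OF norm_triangle_ineq4] add_right_mono norm_triangle_ineq)
    also have "norm (2 * (a + b + c)) \<le> 2 * (A + B + C)"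
    proof -
      have "norm (a + b + c) \<le> A + B + C"
        unfolding A_def B_def C_def
        by (intro order.trans[OF norm_triangle_ineq] add_right_mono norm_triangle_ineq)
      then have "2 * norm (a + b + c) \<le> 2 * (A + B + C)" by simp
      then show ?thesis by (subst norm_mult) (simp only: norm_numeral)
    qed
    finally show ?thesis by simp
  qed
  ultimately have main: "4 * (A * B * C) \<le> (A + B + C) ^ 2 + 5 + 2 * (A + B + C)" by linarith
  \<comment> \<open>As \<open>C\<close> lies between \<open>B\<close> and \<open>2 * A * B\<close>,
    its square has a bound linear in \<open>C\<close>; the rest is then reduced to
    \<open>C = B\<close> and \<open>A = 3\<close>.\<close>
  have "0 \<le> (C - B) * (2 * A * B - C)" using AB less by simp
  then have "C ^ 2 \<le> C * B + 2 * A * B * C - 2 * A * B * B" by (simp add: power2_eq_square algebra_simps)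
  with main have "C * (2 * A * B - 3 * B - 2 * A - 2) + 2 * A * B * B \<le> (A + B) ^ 2 + 5 + 2 * (A + B)"
    by (simp add: power2_eq_square algebra_simps)
  moreover have "B * (2 * A * B - 3 * B - 2 * A - 2) \<le> C * (2 * A * B - 3 * B - 2 * A - 2)"
  proof (rule mult_right_mono)
    have "3 * (2 * B - 2) \<le> A * (2 * B - 2)" using AB by (intro mult_right_mono) auto
    then show "0 \<le> 2 * A * B - 3 * B - 2 * A - 2" using AB by (simp add: algebra_simps)
  qed (use AB in simp)
  moreover have "3 * (4 * B * B - 4 * B - 2) \<le> A * (4 * B * B - 4 * B - 2)"
  proof (rule mult_right_mono)
    have "3 * (4 * B) \<le> B * (4 * B)" using AB by (intro mult_right_mono) auto
    then have "12 * B \<le> 4 * B * B" by simp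
    then show "0 \<le> 4 * B * B - 4 * B - 2" using AB by linarith
  qed (use AB in simp)
  moreover have "A * A \<le> B * B" using AB by (intro mult_mono) auto
  moreover have "3 * B \<le> B * B" using AB by (intro mult_right_mono) auto
  ultimately show False using AB by (simp add: power2_eq_square algebra_simps)
qed

text \<open>The regularity relation is symmetric, so \<open>x\<close> and \<open>x'\<close> are
  roots of one quadratic. If they differ, \<open>(x - x') ^ 2\<close> is its discriminant
  \<open>16 * (b * d + 1)\<close>, too large for
  \<open>norm (x - x') \<le> 2 * norm b\<close>.\<close>

lemma regular_unique:
  fixes x x' b d :: complex
  assumes "(d - x - b) ^ 2 = 4 * (x * b + 1)" "(d - x' - b) ^ 2 = 4 * (x' * b + 1)"
    and "norm x \<le> norm b" "norm x' \<le> norm b" "3 \<le> norm b" "norm b \<le> norm d"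
  shows "x = x'"
proof (rule ccontr)
  assume "x \<noteq> x'"
  have 1: "(x - b - d) ^ 2 = 4 * (b * d + 1)" "(x' - b - d) ^ 2 = 4 * (b * d + 1)"
    using assms(1,2) by (simp_all add: power2_eq_square algebra_simps)
  then have "(x - b - d) ^ 2 - (x' - b - d) ^ 2 = 0" by simp
  also have "(x - b - d) ^ 2 - (x' - b - d) ^ 2 = (x - x') * (x + x' - 2 * b - 2 * d)"
    by (simp add: power2_eq_square algebra_simps)
  finally have "(x - x') * (x + x' - 2 * b - 2 * d) = 0" .
  then have "x + x' - 2 * b - 2 * d = 0" using \<open>x \<noteq> x'\<close> by (metis mult_eq_0_iff right_minus_eq)
  then have "x - x' = 2 * (x - b - d)" by algebra
  then have "(x - x') ^ 2 = 4 * (x - b - d) ^ 2" by (simp only: power_mult_distrib) simp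
  then have "(x - x') ^ 2 = 16 * (b * d + 1)" unfolding 1 by simp
  then have "16 * norm (b * d + 1) = norm (x - x') ^ 2" by (metis norm_mult norm_numeral norm_power)
  also have "\<dots> \<le> (2 * norm b) ^ 2"
    using norm_triangle_ineq4[of x x'] assms by (intro power_mono) auto
  finally have "4 * norm (b * d + 1) \<le> norm b * norm b" by (simp add: power2_eq_square)
  moreover have "norm b * norm d \<le> norm (b * d + 1) + 1"
    using norm_triangle_ineq4[of "b * d + 1" 1] by (simp add: norm_mult)
  moreover have "norm b * norm b \<le> norm b * norm d" using assms by (intro mult_left_mono) auto
  moreover have "3 * 3 \<le> norm b * norm b" using assms by (intro mult_mono) auto
  ultimately show False by linarith
qed

section \<open>Growth along a tuple sorted by absolute value\<close>

lemma growth_step: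
  fixes y :: "nat \<Rightarrow> real"
  assumes "p ^ a * x ^ b \<le> y (i + 2)" "p ^ c * x ^ d \<le> y i" "y (i + 2) * y i \<le> y (i + 3)" "0 \<le> p" "0 \<le> x"
  shows "p ^ (a + c) * x ^ (b + d) \<le> y (i + 3)"
proof -
  have "p ^ (a + c) * x ^ (b + d) = (p ^ a * x ^ b) * (p ^ c * x ^ d)" by (simp add: power_add)
  also have "\<dots> \<le> y (i + 2) * y i"
    using assms by (intro mult_mono order.trans[OF _ assms(1)]) auto
  finally show ?thesis using assms(3) by simp
qed

text \<open>The exponents follow the recursion \<open>e (i + 3) = e (i + 2) + e i\<close>.\<close>

lemma growth:
  fixes y :: "nat \<Rightarrow> real"
  assumes mono: "\<And>i. i < 20 \<Longrightarrow> y i \<le> y (Suc i)" and step: "\<And>i. i \<le> 17 \<Longrightarrow> y (i + 2) * y i \<le> y (i + 3)"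
    and y0: "0 \<le> y 0"
  shows "y 1 ^ 41 * y 0 ^ 19 \<le> y 12" "y 12 ^ 13 \<le> y 20"
proof -
  define p where "p = y 1"
  define x where "x = y 0"
  define q where "q = y 12"
  have mono': "i \<le> j \<Longrightarrow> j \<le> 20 \<Longrightarrow> y i \<le> y j" for i j
    by (induction j rule: dec_induct) (auto intro: order.trans[OF _ mono])
  have nonneg: "0 \<le> p" "0 \<le> x" "0 \<le> q"
    using mono'[of 0 1] mono'[of 0 12] y0 by (auto simp: p_def x_def q_def)
  note gr = growth_step[of p _ x _ y, OF _ _ step nonneg(1,2)]
  have e0: "p ^ 0 * x ^ 1 \<le> y 0" and e1: "p ^ 1 * x ^ 0 \<le> y 1" and e2: "p ^ 1 * x ^ 0 \<le> y 2"
    using mono'[of 1 2] by (simp_all add: p_def x_def)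
  have e3: "p ^ 1 * x ^ 1 \<le> y 3" using gr[of 1 0 0 0 1] e2 e0 by (simp add: numeral_eq_Suc)
  have e4: "p ^ 2 * x ^ 1 \<le> y 4" using gr[of 1 1 1 1 0] e3 e1 by (simp add: numeral_eq_Suc)
  have e5: "p ^ 3 * x ^ 1 \<le> y 5" using gr[of 2 1 2 1 0] e4 e2 by (simp add: numeral_eq_Suc)
  have e6: "p ^ 4 * x ^ 2 \<le> y 6" using gr[of 3 1 3 1 1] e5 e3 by (simp add: numeral_eq_Suc)
  have e7: "p ^ 6 * x ^ 3 \<le> y 7" using gr[of 4 2 4 2 1] e6 e4 by (simp add: numeral_eq_Suc)
  have e8: "p ^ 9 * x ^ 4 \<le> y 8" using gr[of 6 3 5 3 1] e7 e5 by (simp add: numeral_eq_Suc)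
  have e9: "p ^ 13 * x ^ 6 \<le> y 9" using gr[of 9 4 6 4 2] e8 e6 by (simp add: numeral_eq_Suc)
  have e10: "p ^ 19 * x ^ 9 \<le> y 10" using gr[of 13 6 7 6 3] e9 e7 by (simp add: numeral_eq_Suc)
  have e11: "p ^ 28 * x ^ 13 \<le> y 11" using gr[of 19 9 8 9 4] e10 e8 by (simp add: numeral_eq_Suc)
  have e12: "p ^ 41 * x ^ 19 \<le> y 12" using gr[of 28 13 9 13 6] e11 e9 by (simp add: numeral_eq_Suc)
  then show "y 1 ^ 41 * y 0 ^ 19 \<le> y 12" by (simp add: p_def x_def)
  \<comment> \<open>Restart at index 12, with \<open>q\<close> bounding three consecutive values
    from below; the exponents run 1, 1, 1, 2, 3, 4, 6, 9, 13.\<close>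
  note gr = growth_step[of q _ 1 0 y _ _ 0, OF _ _ step nonneg(3), simplified]
  have f12: "q ^ 1 \<le> y 12" and f13: "q ^ 1 \<le> y 13" and f14: "q ^ 1 \<le> y 14"
    using mono'[of 12 13] mono'[of 12 14] by (simp_all add: q_def)
  have f15: "q ^ 2 \<le> y 15" using gr[of 1 12 1] f14 f12 by (simp add: numeral_eq_Suc)
  have f16: "q ^ 3 \<le> y 16" using gr[of 2 13 1] f15 f13 by (simp add: numeral_eq_Suc)
  have f17: "q ^ 4 \<le> y 17" using gr[of 3 14 1] f16 f14 by (simp add: numeral_eq_Suc)
  have f18: "q ^ 6 \<le> y 18" using gr[of 4 15 2] f17 f15 by (simp add: numeral_eq_Suc)
  have f19: "q ^ 9 \<le> y 19" using gr[of 6 16 3] f18 f16 by (simp add: numeral_eq_Suc)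
  have f20: "q ^ 13 \<le> y 20" using gr[of 9 17 4] f19 f17 by (simp add: numeral_eq_Suc)
  then show "y 12 ^ 13 \<le> y 20" by (simp add: q_def)
qed

lemma sorted_by_norm_list:
  assumes "finite A"
  obtains xs :: "complex list" where "set xs = A" "distinct xs" "sorted (map norm xs)" "length xs = card A"
proof -
  obtain ys where ys: "set ys = A" "distinct ys" using finite_distinct_list[OF assms] by blast
  then show ?thesis using that[of "sort_key norm ys"] by (auto simp: distinct_card)
qed

lemma (in discrete_ring) card_large_elements:
  assumes A: "finite A" "A \<subseteq> R" and large: "\<And>a. a \<in> A \<Longrightarrow> 3 \<le> norm a"
    and sq: "\<And>a b. a \<in> A \<Longrightarrow> b \<in> A \<Longrightarrow> a \<noteq> b \<Longrightarrow> \<exists>c\<in>R. a * b + 1 = c ^ 2"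
  shows "card A \<le> 20"
proof (rule ccontr)
  assume "\<not> card A \<le> 20"
  obtain xs where xs: "set xs = A" "distinct xs" "sorted (map norm xs)" "length xs = card A"
    using sorted_by_norm_list[OF A(1)] .
  have len: "i \<le> 20 \<Longrightarrow> i < length xs" for i using \<open>\<not> card A \<le> 20\<close> xs by simp
  have mem: "xs ! i \<in> A" if "i \<le> 20" for i using nth_mem[OF len[OF that]] xs(1) by simp
  have mem_R: "xs ! i \<in> R" if "i \<le> 20" for i using mem[OF that] A by blast
  have neq: "xs ! i \<noteq> xs ! j" if "i \<le> 20" "j \<le> 20" "i \<noteq> j" for i j
    using that len xs(2) by (simp add: nth_eq_iff_index_eq)
  have root: "\<exists>c\<in>R. xs ! i * xs ! j + 1 = c ^ 2" if "i \<le> 20" "j \<le> 20" "i \<noteq> j" for i j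
    using that by (intro sq mem neq)
  have le: "norm (xs ! i) \<le> norm (xs ! j)" if "i \<le> j" "j \<le> 20" for i j
  proof -
    have lt: "i < length xs" "j < length xs" using that len by auto
    then have "map norm xs ! i \<le> map norm xs ! j" using that(1) by (intro sorted_nth_mono[OF xs(3)]) auto
    then show ?thesis using lt by (simp only: nth_map)
  qed
  \<comment> \<open>Doubling absorbs the factor 2 of the gap inequality, leaving
    \<open>y (i + 2) * y i \<le> y (i + 3)\<close>.\<close>
  define y where "y = (\<lambda>i. 2 * norm (xs ! i))"
  have gap: "2 * norm (xs ! i) * norm (xs ! j) \<le> norm (xs ! l)"
    if ijl: "i < j" "j < l" "l \<le> 20" "(xs ! l - xs ! i - xs ! j) ^ 2 \<noteq> 4 * (xs ! i * xs ! j + 1)" for i j l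
  proof -
    have bounds: "i \<le> 20" "j \<le> 20" "i \<noteq> j" "i \<noteq> l" "j \<noteq> l" "i \<le> j" "j \<le> l" using ijl by auto
    obtain r where r: "r \<in> R" "xs ! i * xs ! j + 1 = r ^ 2" using root[OF bounds(1,2,3)] by blast
    obtain s where s: "s \<in> R" "xs ! i * xs ! l + 1 = s ^ 2" using root[OF bounds(1) ijl(3) bounds(4)] by blast
    obtain t where t: "t \<in> R" "xs ! j * xs ! l + 1 = t ^ 2" using root[OF bounds(2) ijl(3) bounds(5)] by blast
    have nonreg: "(xs ! l - xs ! i - xs ! j) ^ 2 - 4 * (xs ! i * xs ! j + 1) \<noteq> 0" using ijl(4) by simp
    show ?thesis
      by (rule triple_gap[OF mem_R[OF bounds(1)] mem_R[OF bounds(2)] mem_R[OF ijl(3)] r(1) s(1) t(1) r(2) s(2) t(2)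
            nonreg large[OF mem[OF bounds(1)]] le[OF bounds(6,2)] le[OF bounds(7) ijl(3)]])
  qed
  have step: "y (i + 2) * y i \<le> y (i + 3)" if i: "i \<le> 17" for i
  proof -
    have "2 * norm (xs ! i) * norm (xs ! (i + 2)) \<le> norm (xs ! (i + 3))"
    proof (cases "(xs ! (i + 3) - xs ! i - xs ! (i + 2)) ^ 2 = 4 * (xs ! i * xs ! (i + 2) + 1)")
      \<comment> \<open>If \<open>i\<close>, \<open>i + 2\<close>, \<open>i + 3\<close> index a
        regular triple, then \<open>i + 1\<close>, \<open>i + 2\<close>, \<open>i + 3\<close> do
        not, and the gap for \<open>i + 1\<close> is at least as strong.\<close>
      case True
      have "(xs ! (i + 3) - xs ! (i + 1) - xs ! (i + 2)) ^ 2 \<noteq> 4 * (xs ! (i + 1) * xs ! (i + 2) + 1)"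
        using regular_unique[OF True, of "xs ! (i + 1)"] neq[of i "i + 1"] i large[OF mem[of "i + 2"]]
          le[of i "i + 2"] le[of "i + 1" "i + 2"] le[of "i + 2" "i + 3"] by auto
      then have "2 * norm (xs ! (i + 1)) * norm (xs ! (i + 2)) \<le> norm (xs ! (i + 3))"
        using i by (intro gap) auto
      moreover have "2 * norm (xs ! i) * norm (xs ! (i + 2)) \<le> 2 * norm (xs ! (i + 1)) * norm (xs ! (i + 2))"
        using i by (intro mult_right_mono mult_left_mono le) auto
      ultimately show ?thesis by linarith
    qed (use i in \<open>auto intro: gap\<close>)
    then show ?thesis by (simp add: y_def mult_ac)
  qed
  define B where "B = norm (xs ! 1)"
  define C where "C = norm (xs ! 12)"
  define d where "d = norm (xs ! 20)"
  define N where "N = norm (xs ! 0 * xs ! 1 * xs ! 12)"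
  have grow: "y 1 ^ 41 * y 0 ^ 19 \<le> y 12" "y 12 ^ 13 \<le> y 20"
    using growth[of y] step le by (auto simp: y_def)
  have B3: "3 \<le> B" and a3: "3 \<le> norm (xs ! 0)" and aB: "norm (xs ! 0) \<le> B" and BC: "B \<le> C"
    using large[OF mem] le by (auto simp: B_def C_def)
  have C_ge: "2 ^ 78 * B ^ 41 \<le> C"
  proof -
    have "2 * (2 ^ 78 * B ^ 41) = 2 ^ 41 * 4 ^ 19 * B ^ 41" by simp
    also have "\<dots> = (2 * B) ^ 41 * 4 ^ 19" by (simp only: power_mult_distrib ac_simps)
    also have "\<dots> \<le> (2 * B) ^ 41 * (2 * norm (xs ! 0)) ^ 19"
      using B3 a3 by (intro mult_left_mono power_mono) auto
    also have "\<dots> \<le> 2 * C" using grow(1) by (simp add: y_def B_def C_def)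
    finally show ?thesis by simp
  qed
  have d_ge: "2 ^ 12 * C ^ 13 \<le> d"
  proof -
    have "2 * (2 ^ 12 * C ^ 13) = (2 * C) ^ 13" by (simp add: power_mult_distrib)
    also have "\<dots> \<le> 2 * d" using grow(2) by (simp add: y_def C_def d_def)
    finally show ?thesis by simp
  qed
  have N_eq: "N = norm (xs ! 0) * B * C" by (simp add: N_def B_def C_def norm_mult)
  have "1 * C \<le> (norm (xs ! 0) * B) * C"
    using B3 a3 BC mult_mono[of 1 "norm (xs ! 0)" 1 B] by (intro mult_right_mono) auto
  then have N_ge: "C \<le> N" by (simp add: N_eq)
  have N_le: "N \<le> B * B * C" unfolding N_eq using aB B3 BC by (intro mult_right_mono) auto
  obtain z where z: "z \<in> R" "xs ! 12 * xs ! 20 + 1 = z ^ 2" using root[of 12 20] by auto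
  have "2 ^ 64 * B ^ 19 \<le> N"
  proof -
    have "2 ^ 64 * B ^ 19 \<le> 2 ^ 78 * B ^ 41" using B3 by (intro mult_mono power_increasing) auto
    with C_ge N_ge show ?thesis by linarith
  qed
  then have "norm z < 384 * B ^ 4 * C * (2 ^ 14 * B ^ 3 * N) ^ 5"
  proof -
    assume N: "2 ^ 64 * B ^ 19 \<le> N"
    obtain s t x y where "s \<in> R" "t \<in> R" "x \<in> R" "y \<in> R" "xs ! 0 * xs ! 12 + 1 = s ^ 2" "xs ! 1 * xs ! 12 + 1 = t ^ 2"
      "xs ! 0 * xs ! 20 + 1 = x ^ 2" "xs ! 1 * xs ! 20 + 1 = y ^ 2"
      using root[of 0 12] root[of 1 12] root[of 0 20] root[of 1 20] by auto
    moreover have "xs ! 0 \<noteq> xs ! 1" by (rule neq) auto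
    ultimately show ?thesis
      using quadruple_bound[of "xs ! 0" "xs ! 1" "xs ! 12" s t x y z "xs ! 20"] mem_R[of 0] mem_R[of 1] mem_R[of 12] z N a3 aB BC
      by (simp add: B_def C_def N_def)
  qed
  also have "\<dots> \<le> 384 * B ^ 4 * C * (2 ^ 14 * B ^ 3 * (B * B * C)) ^ 5"
    using B3 BC N_le N_ge by (intro mult_left_mono power_mono) auto
  also have "\<dots> = 384 * 2 ^ 70 * B ^ 29 * C ^ 6"
  proof -
    have "2 ^ 14 * B ^ 3 * (B * B * C) = 2 ^ 14 * B ^ 5 * C" by (simp add: eval_nat_numeral)
    moreover have "(2 ^ 14 * B ^ 5 * C) ^ 5 = 2 ^ 70 * B ^ 25 * C ^ 5"
      by (simp only: power_mult_distrib power_mult[symmetric]) simp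
    moreover have "B ^ 29 = B ^ 4 * B ^ 25" by (simp flip: power_add)
    moreover have "C ^ 6 = C * C ^ 5" by (simp flip: power_Suc)
    ultimately show ?thesis by (simp only: ac_simps)
  qed
  also have "\<dots> \<le> 2 ^ 79 * B ^ 29 * C ^ 6" using B3 BC by (intro mult_right_mono) auto
  finally have "norm z < 2 ^ 79 * B ^ 29 * C ^ 6" .
  then have "norm z ^ 2 \<le> (2 ^ 79 * B ^ 29 * C ^ 6) ^ 2" by (intro power_mono) auto
  also have "\<dots> = (2 ^ 158 * B ^ 58) * C ^ 12"
    by (simp only: power_mult_distrib power_mult[symmetric]) simp
  finally have z_le: "norm z ^ 2 \<le> (2 ^ 158 * B ^ 58) * C ^ 12" .
  \<comment> \<open>The lower bound for \<open>z\<close>. With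
    \<open>d \<ge> 2 ^ 12 * C ^ 13\<close> it yields \<open>C ^ 2 < 2 ^ 158 * B ^ 58\<close>, which
    the exponent 41 in \<open>C_ge\<close> refutes.\<close>
  have "C * d \<le> norm z ^ 2 + 1"
    using norm_triangle_ineq4[of "z ^ 2" 1] unfolding z(2)[symmetric]
    by (simp add: C_def d_def norm_mult norm_power[symmetric] z(2)[symmetric])
  moreover have "C * (2 ^ 12 * C ^ 13) \<le> C * d" using d_ge B3 BC by (intro mult_left_mono) auto
  moreover have "C * (2 ^ 12 * C ^ 13) = 4096 * C ^ 14" by (simp flip: power_Suc)
  moreover have "1 \<le> C ^ 14" using B3 BC by simp
  ultimately have "C ^ 14 < norm z ^ 2" by linarith
  then have "C ^ 2 * C ^ 12 < (2 ^ 158 * B ^ 58) * C ^ 12"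
    using z_le by (simp flip: power_add)
  then have "C ^ 2 < 2 ^ 158 * B ^ 58"
    by (rule mult_right_less_imp_less) (use B3 BC in simp)
  also have "\<dots> = (2 ^ 78 * B ^ 29) ^ 2 * 4"
    by (simp only: power_mult_distrib power_mult[symmetric]) simp
  also have "\<dots> \<le> (2 ^ 78 * B ^ 29) ^ 2 * (B ^ 12) ^ 2"
  proof (rule mult_left_mono)
    have "2 \<le> B ^ 12" using B3 power_increasing[of 1 12 B] by simp
    then show "4 \<le> (B ^ 12) ^ 2" using power_mono[of 2 "B ^ 12" 2] by simp
  qed simp
  also have "\<dots> = (2 ^ 78 * B ^ 41) ^ 2"
    by (simp only: power_mult_distrib[symmetric] mult.assoc power_add[symmetric]) simp
  also have "\<dots> \<le> C ^ 2" using C_ge B3 by (intro power_mono) auto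
  finally show False by simp
qed

subsection \<open>Integers of an imaginary quadratic field\<close>

lemma complex_of_real_of_rat: "complex_of_real (of_rat q) = of_rat q"
proof -
  obtain a b where "q = of_int a / of_int b" by (metis quotient_of_div surj_pair)
  then show ?thesis by (simp add: of_rat_divide)
qed

lemma of_rat_in_Reals: "(of_rat q :: complex) \<in> \<real>"
  by (metis complex_of_real_of_rat Reals_of_real)

section \<open>Integer polynomials and integrality of quadratic numbers\<close>

abbreviation ipoly :: "int poly \<Rightarrow> complex \<Rightarrow> complex" where
  "ipoly p x \<equiv> poly (map_poly of_int p) x"

lemma ipoly_pCons: "ipoly (pCons a p) x = of_int a + x * ipoly p x"
  by (simp add: map_poly_pCons)

lemma ipoly_add: "ipoly (p + q) x = ipoly p x + ipoly q x"
  by (induction p q rule: poly_induct2) (simp_all add: ipoly_pCons algebra_simps)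

lemma ipoly_smult: "ipoly (smult c p) x = of_int c * ipoly p x"
  by (induction p) (simp_all add: ipoly_pCons algebra_simps)

lemma ipoly_mult: "ipoly (p * q) x = ipoly p x * ipoly q x"
  by (induction p) (simp_all add: ipoly_pCons ipoly_add ipoly_smult algebra_simps)

lemma monic_quadratic_algebraic_int:
  fixes x :: complex
  assumes "x ^ 2 + of_int p * x + of_int q = 0"
  shows "algebraic_int x"
  unfolding algebraic_int_altdef_ipoly
proof (intro exI conjI)
  show "ipoly [:q, p, 1:] x = 0"
    using assms by (simp add: ipoly_pCons power2_eq_square algebra_simps)
qed simp

text \<open>By Gauss's lemma, the primitive quadratic polynomial vanishing at \<open>x\<close> divides the monic one.\<close>

lemma algebraic_int_quadratic:
  fixes x :: complex and p q :: rat
  assumes x: "algebraic_int x" "x \<notin> \<real>" and root: "x ^ 2 + of_rat p * x + of_rat q = 0"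
  shows "p \<in> \<int>" "q \<in> \<int>"
proof -
  obtain P :: "int poly" where P: "ipoly P x = 0" "lead_coeff P = 1"
    using x(1) unfolding algebraic_int_altdef_ipoly by blast
  obtain a1 b1 where p: "p = of_int a1 / of_int b1" "b1 > 0"
    by (metis Fract_of_int_quotient quotient_of_denom_pos quotient_of_div surj_pair)
  obtain a2 b2 where q: "q = of_int a2 / of_int b2" "b2 > 0"
    by (metis Fract_of_int_quotient quotient_of_denom_pos quotient_of_div surj_pair)
  define Q0 where "Q0 = [:a2 * b1, a1 * b2, b1 * b2:]"
  define Q where "Q = primitive_part Q0"
  define g where "g = Polynomial.content Q0"
  have "Q0 \<noteq> 0" using p q by (simp add: Q0_def)
  have Q0: "Q0 = smult g Q" by (simp add: Q_def g_def)
  have "g \<noteq> 0" using \<open>Q0 \<noteq> 0\<close> Q0 by auto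
  have deg: "degree Q = 2"
    using p q by (simp add: Q_def Q0_def)
  have contQ: "Polynomial.content Q = 1" unfolding Q_def using \<open>Q0 \<noteq> 0\<close> by (rule content_primitive_part)
  have "ipoly Q0 x = of_int (b1 * b2) * (x ^ 2 + of_rat p * x + of_rat q)"
  proof -
    have "(of_int a1 :: complex) = of_rat p * of_int b1" "(of_int a2 :: complex) = of_rat q * of_int b2"
      using p q by (simp_all add: of_rat_divide)
    then show ?thesis by (simp add: Q0_def ipoly_pCons algebra_simps power2_eq_square)
  qed
  then have "ipoly Q0 x = 0" by (simp add: root)
  moreover have "ipoly Q0 x = of_int g * ipoly Q x"
    unfolding Q0 by (simp add: ipoly_mult ipoly_add ipoly_smult)
  ultimately have Qx: "ipoly Q x = 0" using \<open>g \<noteq> 0\<close> by simp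
  \<comment> \<open>Pseudo-division stays over the integers at the cost of the factor
    \<open>c\<close>. The remainder has degree at most 1 and vanishes at the nonreal
    \<open>x\<close>, so it is zero.\<close>
  obtain S T where ST: "pseudo_divmod P Q = (S, T)" by fastforce
  define c where "c = coeff Q (degree Q) ^ (Suc (degree P) - degree Q)"
  have "Q \<noteq> 0" using deg by auto
  have div: "smult c P = Q * S + T" and T: "T = 0 \<or> degree T < degree Q"
    using pseudo_divmod[OF \<open>Q \<noteq> 0\<close> ST] by (auto simp: c_def)
  have "T = 0"
  proof -
    have Tx: "ipoly T x = 0"
    proof -
      have "of_int c * ipoly P x = ipoly (smult c P) x" by (simp add: ipoly_mult ipoly_add ipoly_smult)
      also have "\<dots> = ipoly T x" unfolding div using Qx by (simp add: ipoly_mult ipoly_add ipoly_smult)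
      finally show ?thesis using P by simp
    qed
    have T1: "T = [:coeff T 0, coeff T 1:]"
    proof (rule poly_eqI)
      fix n show "coeff T n = coeff [:coeff T 0, coeff T 1:] n"
        using T deg by (cases n; cases "n - 1") (auto simp: coeff_eq_0 coeff_pCons split: nat.split)
    qed
    have "of_int (coeff T 0) + x * of_int (coeff T 1) = (0 :: complex)"
      using Tx by (subst (asm) T1) (simp add: ipoly_pCons)
    then have *: "x * of_int (coeff T 1) = of_int (- coeff T 0)" by (simp add: eq_neg_iff_add_eq_0 add.commute)
    have "coeff T 1 = 0"
    proof (rule ccontr)
      assume "coeff T 1 \<noteq> 0"
      then have "x = of_real (of_int (- coeff T 0) / of_int (coeff T 1))" using * by (simp add: field_simps)
      then show False using x(2) by (metis Reals_of_real)
    qed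
    then show "T = 0" using * T1 by simp
  qed
  have "Polynomial.content P = 1"
  proof -
    have "Polynomial.content P dvd 1" using content_dvd_coeff[of P "degree P"] P(2) by simp
    then show ?thesis by (metis is_unit_normalize normalize_content)
  qed
  \<comment> \<open>Since \<open>Q\<close> is primitive, \<open>S\<close> has the same content, so
    \<open>c\<close> divides \<open>S\<close>; cancelling it from the leading coefficients makes
    that of \<open>Q\<close> a unit.\<close>
  then have "Polynomial.content (smult c P) = \<bar>c\<bar>" by simp
  moreover have "Polynomial.content (smult c P) = Polynomial.content S" unfolding div \<open>T = 0\<close> by (simp add: content_mult contQ)
  ultimately have "S = smult \<bar>c\<bar> (primitive_part S)" using content_times_primitive_part[of S] by metis
  then have "smult c P = Q * smult \<bar>c\<bar> (primitive_part S)" using div \<open>T = 0\<close> by simp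
  then have "lead_coeff (smult c P) = lead_coeff (Q * smult \<bar>c\<bar> (primitive_part S))" by simp
  then have "c * 1 = lead_coeff Q * (\<bar>c\<bar> * lead_coeff (primitive_part S))"
    by (simp only: lead_coeff_smult lead_coeff_mult P(2))
  then have "\<bar>c\<bar> = \<bar>lead_coeff Q * (\<bar>c\<bar> * lead_coeff (primitive_part S))\<bar>" by simp
  then have "\<bar>c\<bar> * (\<bar>lead_coeff Q\<bar> * \<bar>lead_coeff (primitive_part S)\<bar>) = \<bar>c\<bar> * 1"
    by (simp only: abs_mult abs_abs ac_simps mult_1_right)
  moreover have "\<bar>c\<bar> \<noteq> 0" using \<open>Q \<noteq> 0\<close> by (simp add: c_def)
  ultimately have "\<bar>lead_coeff Q\<bar> * \<bar>lead_coeff (primitive_part S)\<bar> = 1" by (metis mult_left_cancel)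
  then have "lead_coeff Q dvd 1" by (metis abs_dvd_iff dvd_triv_left)
  then have lc: "lead_coeff Q = 1 \<or> lead_coeff Q = -1" by (simp add: zdvd1_eq abs_eq_iff')
  have coeffs: "b1 * b2 = g * lead_coeff Q" "a1 * b2 = g * coeff Q 1" "a2 * b1 = g * coeff Q 0"
    using arg_cong[OF Q0, of "\<lambda>p. coeff p 2"] arg_cong[OF Q0, of "\<lambda>p. coeff p 1"] arg_cong[OF Q0, of "\<lambda>p. coeff p 0"] deg
    by (simp_all add: Q0_def numeral_2_eq_2)
  have "p = of_int (a1 * b2) / of_int (b1 * b2)" "q = of_int (a2 * b1) / of_int (b1 * b2)"
    using p q by simp_all
  then have "p = of_int (coeff Q 1) / of_int (lead_coeff Q)" "q = of_int (coeff Q 0) / of_int (lead_coeff Q)"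
    unfolding coeffs using \<open>g \<noteq> 0\<close> by simp_all
  then show "p \<in> \<int>" "q \<in> \<int>" using lc by auto
qed

section \<open>Trace, norm and the ring of integers\<close>

locale imaginary_quadratic =
  fixes K :: "complex set"
  assumes K: "imaginary_quadratic_field K"
begin

lemma K_closed:
  "0 \<in> K" "1 \<in> K" "x \<in> K \<Longrightarrow> y \<in> K \<Longrightarrow> x + y \<in> K" "x \<in> K \<Longrightarrow> y \<in> K \<Longrightarrow> x * y \<in> K"
  "x \<in> K \<Longrightarrow> - x \<in> K" "x \<in> K \<Longrightarrow> inverse x \<in> K"
  using K by (auto simp: imaginary_quadratic_field_def complex_subfield_def)

lemma K_diff: "x \<in> K \<Longrightarrow> y \<in> K \<Longrightarrow> x - y \<in> K"
  using K_closed(3)[of x "- y"] K_closed(5) by simp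

lemma K_of_int: "of_int n \<in> K"
proof -
  have "of_nat m \<in> K" for m by (induction m) (auto intro: K_closed)
  then show ?thesis by (cases n) (auto intro: K_closed simp del: of_nat_Suc)
qed

lemma K_of_rat: "of_rat q \<in> K"
proof -
  obtain a b where q: "q = of_int a / of_int b" by (metis quotient_of_div surj_pair)
  show ?thesis
    unfolding q of_rat_divide of_rat_of_int_eq by (simp add: divide_inverse K_closed K_of_int)
qed

lemma K_spanned:
  assumes z: "z \<in> K" "z \<notin> \<real>" and "x \<in> K"
  obtains p q :: rat where "x = of_rat p + of_rat q * z"
proof -
  interpret V: vector_space rat_scale by (rule vector_space_rat_scale)
  have span1: "V.span {1} = range of_rat"
    by (simp add: V.span_singleton rat_scale_def)
  have span2: "x \<in> V.span {z, 1} \<longleftrightarrow> (\<exists>q p. x = of_rat p + of_rat q * z)" for x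
    by (auto simp: V.span_insert span1 rat_scale_def algebra_simps image_iff)
  have "z \<notin> V.span {1}"
    using z(2) unfolding span1 by (metis of_rat_in_Reals rangeE)
  then have indep: "V.independent {z, 1}"
    by (auto simp: V.independent_insert)
  obtain B where B: "B \<subseteq> K" "V.independent B" "K \<subseteq> V.span B" "card B = V.dim K"
    using V.basis_exists .
  have "card B = 2" using B(4) K by (simp add: imaginary_quadratic_field_def degree_over_rat_def)
  \<comment> \<open>Infinite sets have \<open>card\<close> 0, so the value 2 gives
    finiteness.\<close>
  then have "finite B" using card.infinite by fastforce
  have "x \<in> V.span {z, 1}"
  proof (rule ccontr)
    assume x: "x \<notin> V.span {z, 1}"
    then have "V.independent {x, z, 1}" using indep by (auto simp: V.independent_insert)
    moreover have "{x, z, 1} \<subseteq> V.span B" using z \<open>x \<in> K\<close> K_closed(2) B(3) by auto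
    ultimately have "card {x, z, 1} \<le> 2"
      using V.independent_span_bound[OF \<open>finite B\<close>] \<open>card B = 2\<close> by auto
    moreover have "x \<notin> {z, 1}" using x V.span_superset by blast
    moreover have "z \<noteq> 1" using z(2) by auto
    ultimately show False by simp
  qed
  then show ?thesis using that span2 by blast
qed

lemma nonreal_exists: obtains z where "z \<in> K" "z \<notin> \<real>"
  using K by (auto simp: imaginary_quadratic_field_def)

lemma K_real_rational: assumes "x \<in> K" "x \<in> \<real>" shows "x \<in> \<rat>"
proof -
  obtain z where z: "z \<in> K" "z \<notin> \<real>" by (rule nonreal_exists)
  obtain p q where x: "x = of_rat p + of_rat q * z" using K_spanned[OF z assms(1)] .
  have "q = 0"
  proof (rule ccontr)
    assume "q \<noteq> 0"
    then have "z = (x - of_rat p) / of_rat q" by (simp add: x)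
    then show False using z(2) assms(2) by (metis Reals_diff Reals_divide of_rat_in_Reals)
  qed
  then show ?thesis using x by simp
qed

lemma quadratic_equation: "z ^ 2 - complex_of_real (2 * Re z) * z + complex_of_real (norm z ^ 2) = 0"
  unfolding cmod_power2 by (simp add: complex_eq_iff power2_eq_square algebra_simps)

text \<open>For nonreal \<open>z\<close>, write \<open>z ^ 2 = p + q * z\<close> with rational
  \<open>p\<close>, \<open>q\<close>: the imaginary parts give the trace \<open>q\<close>, then the
  real parts give the norm \<open>- p\<close>.\<close>

lemma trace_norm_rational:
  assumes "z \<in> K"
  obtains p q :: rat where "2 * Re z = of_rat p" "norm z ^ 2 = of_rat q"
proof (cases "z \<in> \<real>")
  case True
  then have "z \<in> \<rat>" using K_real_rational assms by blast
  then obtain r where r: "z = of_rat r" by (auto elim: Rats_cases)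
  then have "z = complex_of_real (of_rat r)" by (simp add: complex_of_real_of_rat)
  then have "Re z = of_rat r" "norm z ^ 2 = of_rat r ^ 2"
    by (metis Re_complex_of_real, metis norm_of_real power2_abs)
  then have "2 * Re z = of_rat (2 * r)" "norm z ^ 2 = of_rat (r ^ 2)" by (simp_all add: of_rat_mult of_rat_power)
  then show ?thesis by (rule that)
next
  case False
  obtain p q where pq: "z ^ 2 = of_rat p + of_rat q * z"
    using K_spanned[OF assms False, of "z ^ 2"] K_closed(4)[OF assms assms] by (metis power2_eq_square)
  have of_rat_real: "(of_rat r :: complex) = complex_of_real (of_rat r)" for r by (simp add: complex_of_real_of_rat)
  have "Im z \<noteq> 0" using False by (simp add: complex_is_Real_iff)
  have im: "2 * Re z * Im z = of_rat q * Im z" and re: "Re z ^ 2 - Im z ^ 2 = of_rat p + of_rat q * Re z"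
    using pq unfolding of_rat_real by (simp_all add: complex_eq_iff Re_power2 Im_power2)
  then have tr: "2 * Re z = of_rat q" using \<open>Im z \<noteq> 0\<close> by simp
  have "norm z ^ 2 = of_rat (- p)"
    using re unfolding tr[symmetric] cmod_power2 by (simp add: of_rat_minus power2_eq_square)
  with tr show ?thesis by (rule that)
qed

text \<open>Reduces integrality to two real numbers, so that closure under subtraction and
  multiplication can be checked on traces and norms.\<close>

lemma ring_of_integers_iff: "z \<in> ring_of_integers K \<longleftrightarrow> z \<in> K \<and> 2 * Re z \<in> \<int> \<and> norm z ^ 2 \<in> \<int>"
proof (intro iffI conjI)
  assume "z \<in> K \<and> 2 * Re z \<in> \<int> \<and> norm z ^ 2 \<in> \<int>"
  then obtain t n where "z \<in> K" "2 * Re z = of_int t" "norm z ^ 2 = of_int n" by (auto elim!: Ints_cases)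
  then have "z ^ 2 + of_int (- t) * z + of_int n = 0" using quadratic_equation[of z] by simp
  from monic_quadratic_algebraic_int[OF this] show "z \<in> ring_of_integers K"
    using \<open>z \<in> K\<close> by (simp add: ring_of_integers_def)
next
  assume z: "z \<in> ring_of_integers K"
  then show "z \<in> K" by (simp add: ring_of_integers_def)
  obtain p q where pq: "2 * Re z = of_rat p" "norm z ^ 2 = of_rat q" using trace_norm_rational[OF \<open>z \<in> K\<close>] .
  have "2 * Re z \<in> \<int> \<and> norm z ^ 2 \<in> \<int>"
  proof (cases "z \<in> \<real>")
    case True
    then have "z \<in> \<int>"
      using z K_real_rational by (intro rational_algebraic_int_is_int) (auto simp: ring_of_integers_def)
    then obtain n where n: "z = of_int n" by (auto elim: Ints_cases)
    have "2 * Re z = of_int (2 * n)" "norm z ^ 2 = of_int (n ^ 2)" by (simp_all add: n)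
    then show ?thesis by (metis Ints_of_int)
  next
    case False
    have "z ^ 2 + of_rat (- p) * z + of_rat q = 0"
      using quadratic_equation[of z] unfolding pq complex_of_real_of_rat by (simp add: of_rat_minus)
    then have "- p \<in> \<int>" "q \<in> \<int>"
      using algebraic_int_quadratic[of z "- p" q] z False by (auto simp: ring_of_integers_def)
    then have "p \<in> \<int>" "q \<in> \<int>" by simp_all
    then show ?thesis unfolding pq by (auto elim!: Ints_cases)
  qed
  then show "2 * Re z \<in> \<int>" "norm z ^ 2 \<in> \<int>" by auto
qed

lemma ring_of_integersE:
  assumes "z \<in> ring_of_integers K"
  obtains t n :: int where "2 * Re z = of_int t" "norm z ^ 2 = of_int n" "4 * Im z ^ 2 = of_int (4 * n - t ^ 2)"
proof -
  obtain t n where tn: "2 * Re z = of_int t" "norm z ^ 2 = of_int n"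
    using assms by (auto simp: ring_of_integers_iff elim!: Ints_cases)
  have "4 * Im z ^ 2 = 4 * norm z ^ 2 - (2 * Re z) ^ 2"
    unfolding cmod_power2 by (simp add: power2_eq_square)
  then have "4 * Im z ^ 2 = of_int (4 * n - t ^ 2)" by (simp add: tn)
  with tn show ?thesis by (rule that)
qed

lemma cnj_mem_K: assumes "z \<in> K" shows "cnj z \<in> K"
proof -
  obtain p q where "2 * Re z = of_rat p" "norm z ^ 2 = of_rat q" using trace_norm_rational[OF assms] .
  then have "cnj z = of_rat p - z" by (simp add: complex_eq_iff flip: complex_of_real_of_rat)
  then show ?thesis using K_diff K_of_rat assms by simp
qed

lemma cnj_mem: "z \<in> ring_of_integers K \<Longrightarrow> cnj z \<in> ring_of_integers K"
  by (simp add: ring_of_integers_iff cnj_mem_K)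

text \<open>With \<open>w = 4 * Im x * Im y\<close> one has \<open>2 * Re (x * y) = (T\<^sub>x * T\<^sub>y - w) / 2\<close>, where
  \<open>w\<^sup>2 = (4 * N\<^sub>x - T\<^sub>x\<^sup>2) * (4 * N\<^sub>y - T\<^sub>y\<^sup>2)\<close> gives \<open>w\<close> the parity of \<open>T\<^sub>x * T\<^sub>y\<close>.\<close>

lemma trace_mult_Ints:
  assumes x: "x \<in> ring_of_integers K" and y: "y \<in> ring_of_integers K"
  shows "2 * Re (x * y) \<in> \<int>"
proof -
  obtain t n where tn: "2 * Re x = of_int t" "norm x ^ 2 = of_int n" "4 * Im x ^ 2 = of_int (4 * n - t ^ 2)"
    using ring_of_integersE[OF x] .
  obtain t' n' where tn': "2 * Re y = of_int t'" "norm y ^ 2 = of_int n'" "4 * Im y ^ 2 = of_int (4 * n' - t' ^ 2)"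
    using ring_of_integersE[OF y] .
  define w where "w = 4 * Im x * Im y"
  have w2: "w ^ 2 = of_int ((4 * n - t ^ 2) * (4 * n' - t' ^ 2))"
    unfolding of_int_mult tn(3)[symmetric] tn'(3)[symmetric] by (simp add: w_def power_mult_distrib)
  have "x * y \<in> K" using x y K_closed(4) by (auto simp: ring_of_integers_def)
  then obtain p q where p: "2 * Re (x * y) = of_rat p" "norm (x * y) ^ 2 = of_rat q" using trace_norm_rational by blast
  have re: "2 * (2 * Re (x * y)) = of_int (t * t') - w"
    by (simp add: w_def algebra_simps flip: tn tn')
  then have "w = of_rat (of_int (t * t') - 2 * p)" unfolding p by (simp add: of_rat_diff of_rat_mult)
  \<comment> \<open>\<open>w\<close> is rational because the trace of \<open>x * y\<close> is, and
    its square is an integer; hence \<open>w\<close> is an integer.\<close>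
  then have "complex_of_real w \<in> \<rat>" by (simp add: complex_of_real_of_rat)
  moreover have "complex_of_real w ^ 2 + of_int 0 * complex_of_real w + of_int (- ((4 * n - t ^ 2) * (4 * n' - t' ^ 2))) = 0"
    using arg_cong[OF w2, of complex_of_real] by simp
  then have "algebraic_int (complex_of_real w)" by (rule monic_quadratic_algebraic_int)
  ultimately have "complex_of_real w \<in> \<int>" by (intro rational_algebraic_int_is_int)
  then obtain v where "complex_of_real w = of_int v" by (auto elim: Ints_cases)
  then have v: "w = of_int v" by (metis of_real_eq_iff of_real_of_int_eq)
  have "v ^ 2 = (4 * n - t ^ 2) * (4 * n' - t' ^ 2)"
    using w2 unfolding v by (simp only: of_int_power[symmetric] of_int_eq_iff)
  then have "even (v ^ 2) \<longleftrightarrow> even ((4 * n - t ^ 2) * (4 * n' - t' ^ 2))" by simp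
  then have "even (t * t' - v)" by auto
  then obtain u where "t * t' - v = 2 * u" by (elim evenE)
  then have "of_int (t * t') - w = 2 * of_int u" unfolding v by (metis of_int_diff of_int_mult of_int_numeral)
  then have "2 * Re (x * y) = of_int u" using re by linarith
  then show ?thesis by simp
qed

sublocale discrete_ring "ring_of_integers K"
proof
  fix x y assume x: "x \<in> ring_of_integers K" and y: "y \<in> ring_of_integers K"
  \<comment> \<open>The cross term is the trace of \<open>x * cnj y\<close>, an integer by the
    product case.\<close>
  have "norm (x - y) ^ 2 = norm x ^ 2 + norm y ^ 2 - 2 * Re (x * cnj y)"
    unfolding cmod_power2 by (simp add: power2_eq_square algebra_simps)
  moreover have "2 * Re (x - y) = 2 * Re x - 2 * Re y" by simp
  ultimately show "x - y \<in> ring_of_integers K"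
    using x y trace_mult_Ints[OF x cnj_mem[OF y]] unfolding ring_of_integers_iff
    by (auto intro: K_diff)
  show "x * y \<in> ring_of_integers K"
    using x y trace_mult_Ints[OF x y] unfolding ring_of_integers_iff
    by (auto intro: K_closed simp: norm_mult power_mult_distrib)
  show "1 \<le> norm x" if "x \<noteq> 0"
  proof -
    obtain t n where n: "norm x ^ 2 = of_int n" using ring_of_integersE[OF x] by metis
    moreover have "norm x ^ 2 > 0" using that by simp
    ultimately have "n \<ge> 1" by simp
    then have "1 \<le> norm x ^ 2" unfolding n by simp
    then show ?thesis by (simp add: power2_nonneg_ge_1_iff)
  qed
qed (simp add: ring_of_integers_iff K_closed)

end

subsection \<open>Small elements\<close>

text \<open>Pairs (trace, multiple of the minimal height), one for each
  \<open>\<plusminus> z\<close>, that satisfy \<open>T ^ 2 + \<Delta> * j ^ 2 \<le> 32\<close> and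
  the parity of \<open>T - j * \<tau>\<close> for some admissible \<open>\<Delta>\<close>. Only the
  parity of \<open>\<tau>\<close> matters, so the bound 15 = 7 + 8 is uniform in the field.\<close>

definition canonical_coords :: "int \<Rightarrow> (int \<times> int) set" where
  "canonical_coords \<tau> = set ([(2, 0), (4, 0), (-4, 2), (-2, 2), (0, 2), (2, 2), (4, 2)] @
    (if even \<tau> then [(-4, 1), (-2, 1), (0, 1), (2, 1), (4, 1)]
     else [(-5, 1), (-3, 1), (-1, 1), (1, 1), (3, 1), (5, 1), (-1, 3), (1, 3)]))"

lemma finite_canonical_coords: "finite (canonical_coords \<tau>)"
  unfolding canonical_coords_def by (rule finite_set)

lemma card_canonical_coords: "card (canonical_coords \<tau>) \<le> 15"
  unfolding canonical_coords_def by (rule order.trans[OF card_length]) simp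

lemma abs_le_of_square_le:
  fixes x b :: int
  assumes "x ^ 2 \<le> c" "c < (b + 1) ^ 2" "0 \<le> b"
  shows "\<bar>x\<bar> \<le> b"
proof -
  have "\<bar>x\<bar> ^ 2 < (b + 1) ^ 2" using assms by simp
  then have "\<bar>x\<bar> < b + 1" by (rule power_less_imp_less_base) (use assms in simp)
  then show ?thesis by simp
qed

lemma mem_canonical_coords:
  fixes T j \<Delta> \<tau> N :: int
  assumes N: "4 * N = T ^ 2 + \<Delta> * j ^ 2" "N \<le> 8" and \<Delta>: "3 \<le> \<Delta>" "even \<tau> \<Longrightarrow> 4 \<le> \<Delta>"
    and par: "even (T - j * \<tau>)" and pos: "0 < j \<or> j = 0 \<and> 0 < T"
  shows "(T, j) \<in> canonical_coords \<tau>"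
proof -
  have \<Delta>j: "3 * j ^ 2 \<le> \<Delta> * j ^ 2" using \<Delta> by (intro mult_right_mono) auto
  have "T ^ 2 \<le> 32" "j ^ 2 \<le> 10"
    using N \<Delta>j zero_le_power2[of j] zero_le_power2[of T] by linarith+
  then have "\<bar>T\<bar> \<le> 5" "\<bar>j\<bar> \<le> 3"
    using abs_le_of_square_le[of T 32 5] abs_le_of_square_le[of j 10 3] by simp_all
  then have T_bounds: "- 5 \<le> T" "T \<le> 5" and j_bounds: "0 \<le> j" "j \<le> 3" using pos by auto
  from T_bounds
  have T: "T = -5 \<or> T = -4 \<or> T = -3 \<or> T = -2 \<or> T = -1 \<or> T = 0 \<or> T = 1 \<or> T = 2 \<or> T = 3 \<or> T = 4 \<or> T = 5"
    by presburger
  from j_bounds have "j = 0 \<or> j = 1 \<or> j = 2 \<or> j = 3" by presburger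
  then consider "j = 0" | "j = 1" | "j = 2" | "j = 3" by blast
  then show ?thesis
  proof cases
    case 1
    then show ?thesis using T par pos by (auto simp: canonical_coords_def)
  next
    case 2
    then show ?thesis using T par by (auto simp: canonical_coords_def)
  next
    case 3
    then have "T ^ 2 \<le> 20" using N \<Delta> by simp
    then show ?thesis using T par 3 by (auto simp: canonical_coords_def)
  next
    case 4
    \<comment> \<open>For \<open>j = 3\<close> only \<open>\<Delta> = 3\<close> fits, as
      \<open>4 * 9 > 32\<close>; even \<open>\<tau>\<close> would need
      \<open>\<Delta> \<ge> 4\<close>.\<close>
    then have "T ^ 2 \<le> 5" "odd \<tau>" using N \<Delta> zero_le_power2[of T] by force+
    then show ?thesis using T par 4 by (auto simp: canonical_coords_def)
  qed
qed

definition special_coords :: "(int \<times> int) set" where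
  "special_coords = {(2, 0), (4, 0), (0, 1), (0, 2), (3, 1), (-3, 1)}"

text \<open>Put \<open>d = 1 + N - w\<close>, so \<open>T ^ 2 = d * (2 + 2 * N - d)\<close>. For
  \<open>d = 1\<close> this is \<open>2 * N + 1\<close>, leaving \<open>T = 3\<close>. For
  \<open>d \<ge> 2\<close> it is at least \<open>4 * N\<close>, hence equal to it.\<close>

lemma pythagorean_small:
  fixes T N w :: int
  assumes "0 \<le> T" "T \<le> 5" "1 \<le> N" "N \<le> 8" "0 \<le> w" and eq: "w ^ 2 + T ^ 2 = (1 + N) ^ 2" and le: "T ^ 2 \<le> 4 * N"
  shows "T = 0 \<or> T = 3 \<or> T = 2 \<and> N = 1 \<or> T = 4 \<and> N = 4"
proof (cases "T = 0")
  case False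
  have T: "T = 1 \<or> T = 2 \<or> T = 3 \<or> T = 4 \<or> T = 5" using False assms(1,2) by presburger
  define d where "d = 1 + N - w"
  have "0 < T ^ 2" using False by simp
  then have "w ^ 2 < (1 + N) ^ 2" using eq by linarith
  then have "w < 1 + N" by (rule power_less_imp_less_base) (use assms in simp)
  then have d: "1 \<le> d" "d \<le> 1 + N" using assms(5) by (simp_all add: d_def)
  have Td: "T ^ 2 = d * (2 + 2 * N - d)"
    using eq by (simp add: d_def power2_eq_square algebra_simps)
  show ?thesis
  proof (cases "d = 1")
    case True
    then have "T ^ 2 = 2 * N + 1" using Td by simp
    moreover from this have "odd (T ^ 2)" by simp
    then have "T \<noteq> 4" "T \<noteq> 2" by auto
    ultimately show ?thesis using T assms(3,4) by auto
  next
    case False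
    then have "0 \<le> (d - 2) * (2 * N - d)" using d assms(3) by (intro mult_nonneg_nonneg) auto
    then have "T ^ 2 = 4 * N" using Td le by (simp add: algebra_simps)
    moreover from this have "even (T ^ 2)" by simp
    then have "T \<noteq> 1" "T \<noteq> 3" "T \<noteq> 5" by auto
    ultimately show ?thesis using T by auto
  qed
qed simp

lemma mem_special_coords:
  fixes T j \<Delta> \<tau> N w :: int
  assumes N: "4 * N = T ^ 2 + \<Delta> * j ^ 2" "1 \<le> N" "N \<le> 8" and \<Delta>: "3 \<le> \<Delta>"
    and mem: "(T, j) \<in> canonical_coords \<tau>" and w: "0 \<le> w" "w ^ 2 + T ^ 2 = (1 + N) ^ 2"
  shows "(T, j) \<in> special_coords"
proof -
  have "0 \<le> \<Delta> * j ^ 2" using \<Delta> by simp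
  moreover have "\<bar>T\<bar> \<le> 5" using mem by (auto simp: canonical_coords_def split: if_splits)
  ultimately have *: "T = 0 \<or> \<bar>T\<bar> = 3 \<or> \<bar>T\<bar> = 2 \<and> N = 1 \<or> \<bar>T\<bar> = 4 \<and> N = 4"
    using pythagorean_small[of "\<bar>T\<bar>" N w] N w by simp
  have "j = 0" if "\<Delta> * j ^ 2 = 0" using that \<Delta> by simp
  then have "T = 0 \<or> \<bar>T\<bar> = 3 \<or> (\<bar>T\<bar> = 2 \<or> \<bar>T\<bar> = 4) \<and> j = 0"
    using * N(1) by (elim disjE) (auto simp: abs_eq_iff')
  moreover have "j = 1 \<or> j = 2" if "T = 0"
    using mem unfolding that by (auto simp: canonical_coords_def split: if_splits)
  moreover have "j = 1" if "T = 3"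
    using mem unfolding that by (auto simp: canonical_coords_def split: if_splits)
  moreover have "j = 1" if "T = - 3"
    using mem unfolding that by (auto simp: canonical_coords_def split: if_splits)
  moreover have "T = 2 \<or> T = 4" if "j = 0"
    using mem unfolding that by (auto simp: canonical_coords_def split: if_splits)
  ultimately show ?thesis
    by (elim disjE conjE) (auto simp: special_coords_def abs_if split: if_splits)
qed

section \<open>Lattice coordinates and the count of small integers\<close>

context imaginary_quadratic
begin

text \<open>\<open>4 * Im z ^ 2\<close> is an integer for integral \<open>z\<close>, so
  well-ordering applies.\<close>

lemma minimal_height:
  obtains \<omega> where "\<omega> \<in> ring_of_integers K" "0 < Im \<omega>"
    "\<forall>z\<in>ring_of_integers K. 0 < Im z \<longrightarrow> Im \<omega> \<le> Im z"
proof -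
  define P where "P = (\<lambda>n :: nat. \<exists>z\<in>ring_of_integers K. 0 < Im z \<and> 4 * Im z ^ 2 = real n)"
  have P: "\<exists>n. P n \<and> 4 * Im z ^ 2 = real n" if z: "z \<in> ring_of_integers K" "0 < Im z" for z
  proof -
    obtain t n where tn: "4 * Im z ^ 2 = of_int (4 * n - t ^ 2)" using ring_of_integersE[OF z(1)] by metis
    have "0 \<le> 4 * Im z ^ 2" by simp
    then have "0 \<le> 4 * n - t ^ 2" unfolding tn by (simp only: of_int_0_le_iff)
    then have "4 * Im z ^ 2 = real (nat (4 * n - t ^ 2))" unfolding tn by (simp only: of_nat_nat)
    then show ?thesis using z unfolding P_def by blast
  qed
  have "\<exists>n. P n"
  proof -
    obtain z where z: "z \<in> K" "z \<notin> \<real>" by (rule nonreal_exists)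
    obtain p q where pq: "2 * Re z = of_rat p" "norm z ^ 2 = of_rat q" using trace_norm_rational[OF z(1)] .
    obtain a1 b1 where p: "p = of_int a1 / of_int b1" "b1 > 0"
      by (metis Fract_of_int_quotient quotient_of_denom_pos quotient_of_div surj_pair)
    obtain a2 b2 where q: "q = of_int a2 / of_int b2" "b2 > 0"
      by (metis Fract_of_int_quotient quotient_of_denom_pos quotient_of_div surj_pair)
    \<comment> \<open>Both denominators are cleared, which produces a nonreal integer.\<close>
    define x where "x = of_int (b1 * b2) * z"
    have "2 * Re x = of_int (b1 * b2) * (2 * Re z)" by (simp add: x_def)
    also have "\<dots> = of_int (a1 * b2)" unfolding pq p(1) using p(2) by (simp add: of_rat_divide)
    finally have 1: "2 * Re x \<in> \<int>" by simp
    have "norm x ^ 2 = of_int (b1 * b2) ^ 2 * norm z ^ 2"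
      by (simp only: x_def norm_mult norm_of_int power_mult_distrib power2_abs)
    also have "\<dots> = of_int (b1 * b1 * a2 * b2)" unfolding pq q(1) using q(2)
      by (simp add: of_rat_divide power2_eq_square)
    finally have 2: "norm x ^ 2 \<in> \<int>" by simp
    have x: "x \<in> ring_of_integers K" using 1 2 z K_of_int K_closed(4) by (simp add: ring_of_integers_iff x_def)
    have "Im x \<noteq> 0" using z(2) p(2) q(2) by (simp add: x_def complex_is_Real_iff)
    then have "0 < Im x \<or> 0 < Im (- x)" by auto
    then show ?thesis using P[OF x] P[OF uminus_mem[OF x]] by blast
  qed
  then have "P (LEAST n. P n)" by (rule LeastI_ex)
  then obtain \<omega> where \<omega>: "\<omega> \<in> ring_of_integers K" "0 < Im \<omega>" "4 * Im \<omega> ^ 2 = real (LEAST n. P n)"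
    unfolding P_def by blast
  have "Im \<omega> \<le> Im z" if z: "z \<in> ring_of_integers K" "0 < Im z" for z
  proof -
    obtain n where n: "P n" "4 * Im z ^ 2 = real n" using P[OF z] by blast
    have "Im \<omega> ^ 2 \<le> Im z ^ 2" using Least_le[of P n, OF n(1)] \<omega>(3) n(2) by simp
    then show ?thesis by (rule power2_le_imp_le) (use z in simp)
  qed
  with \<omega> show ?thesis using that by blast
qed

text \<open>An element \<open>\<omega>\<close> of minimal positive height forms an integral basis
  with 1: subtracting a floor multiple of it leaves height 0, hence a rational integer.
  \<open>- \<Delta>\<close> is the discriminant of the minimal polynomial of
  \<open>\<omega>\<close>, so \<open>\<Delta>\<close> is 0 or 3 modulo 4 according to the parity of
  \<open>\<tau>\<close>.\<close>

lemma coordinates: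
  obtains h :: real and \<Delta> \<tau> :: int where "0 < h" "3 \<le> \<Delta>" "even \<tau> \<Longrightarrow> 4 \<le> \<Delta>"
    "\<And>z. z \<in> ring_of_integers K \<Longrightarrow> \<exists>T j N :: int. 2 * Re z = of_int T \<and> Im z = of_int j * h \<and>
      norm z ^ 2 = of_int N \<and> 4 * N = T ^ 2 + \<Delta> * j ^ 2 \<and> even (T - j * \<tau>)"
proof -
  obtain \<omega> where \<omega>: "\<omega> \<in> ring_of_integers K" "0 < Im \<omega>"
    "\<forall>z\<in>ring_of_integers K. 0 < Im z \<longrightarrow> Im \<omega> \<le> Im z" using minimal_height .
  obtain \<tau> n where \<tau>: "2 * Re \<omega> = of_int \<tau>" "norm \<omega> ^ 2 = of_int n" "4 * Im \<omega> ^ 2 = of_int (4 * n - \<tau> ^ 2)"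
    using ring_of_integersE[OF \<omega>(1)] .
  define \<Delta> where "\<Delta> = 4 * n - \<tau> ^ 2"
  have "0 < 4 * Im \<omega> ^ 2" using \<omega>(2) by simp
  then have "0 < \<Delta>" unfolding \<tau>(3) \<Delta>_def by (simp only: of_int_0_less_iff)
  have \<Delta>_even: "4 \<le> \<Delta>" if even: "even \<tau>"
  proof -
    obtain u where "\<tau> = 2 * u" using even by (elim evenE)
    then have "\<Delta> = 4 * (n - u ^ 2)" by (simp add: \<Delta>_def power_mult_distrib algebra_simps)
    then show ?thesis using \<open>0 < \<Delta>\<close> by presburger
  qed
  have "3 \<le> \<Delta>"
  proof (cases "even \<tau>")
    case False
    then obtain u where "\<tau> = 2 * u + 1" by (elim oddE)
    then have "\<Delta> = 4 * (n - u ^ 2 - u) - 1" by (simp add: \<Delta>_def power2_eq_square algebra_simps)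
    then show ?thesis using \<open>0 < \<Delta>\<close> by presburger
  qed (use \<Delta>_even in auto)
  moreover have "\<exists>T j N :: int. 2 * Re z = of_int T \<and> Im z = of_int j * Im \<omega> \<and>
      norm z ^ 2 = of_int N \<and> 4 * N = T ^ 2 + \<Delta> * j ^ 2 \<and> even (T - j * \<tau>)" if z: "z \<in> ring_of_integers K" for z
  proof -
    obtain T N where TN: "2 * Re z = of_int T" "norm z ^ 2 = of_int N" using ring_of_integersE[OF z] by metis
    define j where "j = \<lfloor>Im z / Im \<omega>\<rfloor>"
    define x where "x = z - of_int j * \<omega>"
    have x: "x \<in> ring_of_integers K" unfolding x_def by (intro diff_mem mult_mem of_int_mem z \<omega>(1))
    have "of_int j \<le> Im z / Im \<omega>" "Im z / Im \<omega> < of_int j + 1" unfolding j_def by linarith+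
    then have "0 \<le> Im x" "Im x < Im \<omega>" using \<omega>(2) by (simp_all add: x_def field_simps)
    then have "Im x = 0" using bspec[OF \<omega>(3) x] by linarith
    then have "x \<in> \<real>" by (simp add: complex_is_Real_iff)
    then have "x \<in> \<int>"
      using x K_real_rational by (intro rational_algebraic_int_is_int) (auto simp: ring_of_integers_def)
    then obtain m where "x = of_int m" by (auto elim: Ints_cases)
    then have m: "z = of_int m + of_int j * \<omega>" by (simp add: x_def algebra_simps)
    have "2 * Re z = 2 * of_int m + of_int j * (2 * Re \<omega>)" by (simp add: m)
    then have "of_int T = (of_int (2 * m + j * \<tau>) :: real)" unfolding TN \<tau> by simp
    then have "T = 2 * m + j * \<tau>" by (simp only: of_int_eq_iff)
    then have "even (T - j * \<tau>)" by simp
    moreover have im: "Im z = of_int j * Im \<omega>" by (simp add: m)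
    moreover have "4 * N = T ^ 2 + \<Delta> * j ^ 2"
    proof -
      have "4 * norm z ^ 2 = (2 * Re z) ^ 2 + 4 * Im z ^ 2" by (simp add: cmod_power2 power_mult_distrib)
      also have "4 * Im z ^ 2 = 4 * Im \<omega> ^ 2 * of_int (j ^ 2)" by (simp add: im power_mult_distrib)
      finally have "of_int (4 * N) = (of_int (T ^ 2 + \<Delta> * j ^ 2) :: real)"
        unfolding TN \<tau>(3) \<Delta>_def by simp
      then show ?thesis by (simp only: of_int_eq_iff)
    qed
    ultimately show ?thesis using TN by blast
  qed
  ultimately show ?thesis using that[of "Im \<omega>" \<Delta> \<tau>] \<omega>(2) \<Delta>_even by blast
qed

text \<open>Up to sign there are at most 15 nonzero integers of norm at most 8. If \<open>z\<close> and \<open>- z\<close> both belong to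
  the set, then \<open>1 - z\<^sup>2\<close> is a square, so \<open>(1 + N)\<^sup>2 - T\<^sup>2\<close> is a square for the norm \<open>N\<close> and the trace \<open>T\<close>
  of \<open>z\<close>; this happens for at most 6 of them.\<close>

lemma card_small_elements:
  assumes S: "finite S" "S \<subseteq> ring_of_integers K" and small: "\<And>z. z \<in> S \<Longrightarrow> 0 < norm z \<and> norm z < 3"
    and sq: "\<And>a b. a \<in> S \<Longrightarrow> b \<in> S \<Longrightarrow> a \<noteq> b \<Longrightarrow> \<exists>c\<in>ring_of_integers K. a * b + 1 = c ^ 2"
  shows "card S \<le> 21"
proof -
  obtain h \<Delta> \<tau> where h: "0 < h" "3 \<le> \<Delta>" "even \<tau> \<Longrightarrow> 4 \<le> \<Delta>"
    "\<And>z. z \<in> ring_of_integers K \<Longrightarrow> \<exists>T j N :: int. 2 * Re z = of_int T \<and> Im z = of_int j * h \<and>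
      norm z ^ 2 = of_int N \<and> 4 * N = T ^ 2 + \<Delta> * j ^ 2 \<and> even (T - j * \<tau>)"
    using coordinates by blast
  define T where "T = (\<lambda>z. \<lfloor>2 * Re z\<rfloor>)"
  define j where "j = (\<lambda>z. \<lfloor>Im z / h\<rfloor>)"
  define N where "N = (\<lambda>z :: complex. \<lfloor>norm z ^ 2\<rfloor>)"
  have coords: "2 * Re z = of_int (T z)" "Im z = of_int (j z) * h" "norm z ^ 2 = of_int (N z)"
     "4 * N z = T z ^ 2 + \<Delta> * j z ^ 2" "even (T z - j z * \<tau>)"
    if z: "z \<in> ring_of_integers K" for z
  proof -
    obtain t i n :: int where tin: "2 * Re z = of_int t" "Im z = of_int i * h" "norm z ^ 2 = of_int n"
      "4 * n = t ^ 2 + \<Delta> * i ^ 2" "even (t - i * \<tau>)"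
      using h(4)[OF z] by blast
    then have "T z = t" "j z = i" "N z = n" using h(1) by (simp_all add: T_def j_def N_def)
    then show "2 * Re z = of_int (T z)" "Im z = of_int (j z) * h" "norm z ^ 2 = of_int (N z)"
     "4 * N z = T z ^ 2 + \<Delta> * j z ^ 2" "even (T z - j z * \<tau>)" using tin by simp_all
  qed
  define f where "f = (\<lambda>z. (T z, j z))"
  define canon where "canon = (\<lambda>z. 0 < j z \<or> j z = 0 \<and> 0 < T z)"
  have f_inj: "x = y" if "x \<in> ring_of_integers K" "y \<in> ring_of_integers K" "f x = f y" for x y
    using that coords(1,2)[of x] coords(1,2)[of y] by (simp add: f_def complex_eq_iff)
  have neg: "T (- z) = - T z" "j (- z) = - j z" if "z \<in> ring_of_integers K" for z
  proof -
    have "of_int (T (- z)) = (of_int (- T z) :: real)" "of_int (j (- z)) * h = of_int (- j z) * h"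
      using coords(1,2)[OF that] coords(1,2)[OF uminus_mem[OF that]] by simp_all
    then show "T (- z) = - T z" "j (- z) = - j z" using h(1) by (simp_all only: of_int_eq_iff mult_cancel_right) auto
  qed
  have bounds: "1 \<le> N z" "N z \<le> 8" if "z \<in> ring_of_integers K" "0 < norm z" "norm z < 3" for z
  proof -
    have "0 < norm z ^ 2" "norm z ^ 2 < 9" using that power_strict_mono[of "norm z" 3 2] by auto
    then have "0 < N z" "real_of_int (N z) < of_int 9" unfolding coords(3)[OF that(1)] by simp_all
    then show "1 \<le> N z" "N z \<le> 8" by simp_all
  qed
  define P where "P = {z \<in> S. canon z}"
  define M where "M = {z \<in> S. \<not> canon z}"
  have PM: "P \<subseteq> S" "M \<subseteq> S" by (auto simp: P_def M_def)
  have canon_mem: "f z \<in> canonical_coords \<tau>" if "z \<in> ring_of_integers K" "canon z" "0 < norm z" "norm z < 3" for z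
    unfolding f_def using coords[OF that(1)] bounds[OF that(1,3,4)] h that(2)
    by (intro mem_canonical_coords[of "N z" _ \<Delta>]) (auto simp: canon_def)
  have neg_canon: "canon (- z)" if "z \<in> M" for z
  proof -
    have z: "z \<in> ring_of_integers K" "z \<noteq> 0" using that PM S small[of z] by auto
    have "T z \<noteq> 0 \<or> j z \<noteq> 0"
      using coords(1,2)[OF z(1)] z(2) h(1) by (auto simp: complex_eq_iff)
    then show ?thesis using that neg[OF z(1)] by (auto simp: canon_def M_def)
  qed
  have P_sub: "f ` P \<subseteq> canonical_coords \<tau>"
    using canon_mem S small by (auto simp: P_def)
  have M_sub: "(\<lambda>z. f (- z)) ` M \<subseteq> canonical_coords \<tau>"
  proof (intro image_subsetI canon_mem neg_canon uminus_mem)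
    fix z assume "z \<in> M"
    then show "z \<in> ring_of_integers K" "0 < norm (- z)" "norm (- z) < 3" "z \<in> M"
      using S PM small[of z] by auto
  qed
  have both: "f ` P \<inter> (\<lambda>z. f (- z)) ` M \<subseteq> special_coords"
  proof
    fix u assume "u \<in> f ` P \<inter> (\<lambda>z. f (- z)) ` M"
    then obtain z z' where z: "z \<in> P" "u = f z" "z' \<in> M" "f z = f (- z')" by auto
    have zR: "z \<in> ring_of_integers K" "z' \<in> ring_of_integers K" "z \<in> S" "z' \<in> S" using z PM S by auto
    have "z = - z'" using f_inj[OF zR(1) uminus_mem[OF zR(2)] z(4)] .
    moreover have "z \<noteq> z'" using z by (auto simp: P_def M_def)
    ultimately obtain c where c: "c \<in> ring_of_integers K" "1 - z ^ 2 = c ^ 2"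
      using sq[OF zR(3,4)] by (auto simp: power2_eq_square)
    \<comment> \<open>The two factors are \<open>1 - T + N\<close> and \<open>1 + T + N\<close>; as
      \<open>1 - z ^ 2 = c ^ 2\<close>, their product is the square of the norm of
      \<open>c\<close>.\<close>
    have "norm (1 - z ^ 2) ^ 2 = norm (1 - z) ^ 2 * norm (1 + z) ^ 2"
      by (simp flip: norm_mult power_mult_distrib) (simp add: power2_eq_square algebra_simps)
    also have "norm (1 - z) ^ 2 = 1 - 2 * Re z + norm z ^ 2"
      unfolding cmod_power2 by (simp add: power2_eq_square algebra_simps)
    also have "norm (1 + z) ^ 2 = 1 + 2 * Re z + norm z ^ 2"
      unfolding cmod_power2 by (simp add: power2_eq_square algebra_simps)
    finally have "of_int (N c ^ 2) = (of_int ((1 - T z + N z) * (1 + T z + N z)) :: real)"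
      using coords(3)[OF c(1)] coords(1,3)[OF zR(1)] unfolding c(2) by (simp add: norm_power)
    then have "N c ^ 2 = (1 - T z + N z) * (1 + T z + N z)" by (simp only: of_int_eq_iff)
    then have "N c ^ 2 + T z ^ 2 = (1 + N z) ^ 2" by (simp add: power2_eq_square algebra_simps)
    moreover have "0 \<le> N c" by (simp add: N_def)
    moreover have "u \<in> canonical_coords \<tau>" using P_sub z by blast
    ultimately show "u \<in> special_coords"
      unfolding z(2) f_def using coords(4)[OF zR(1)] bounds[OF zR(1)] small[OF zR(3)] h(2)
      by (intro mem_special_coords[of "N z" _ \<Delta> _ \<tau> "N c"]) auto
  qed
  have "card S = card P + card M"
    using S(1) by (subst card_Un_disjoint[symmetric]) (auto simp: P_def M_def intro: arg_cong[of _ _ card])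
  also have "card P = card (f ` P)"
    using S PM by (intro card_image[symmetric] inj_onI f_inj) auto
  also have "card M = card ((\<lambda>z. f (- z)) ` M)"
  proof (intro card_image[symmetric] inj_onI)
    fix x y assume "x \<in> M" "y \<in> M" "f (- x) = f (- y)"
    then have "- x = - y" using S PM by (intro f_inj uminus_mem) auto
    then show "x = y" by simp
  qed
  also have "card (f ` P) + card ((\<lambda>z. f (- z)) ` M) =
      card (f ` P \<union> (\<lambda>z. f (- z)) ` M) + card (f ` P \<inter> (\<lambda>z. f (- z)) ` M)"
    using S(1) PM by (intro card_Un_Int finite_imageI) (auto intro: finite_subset)
  also have "\<dots> \<le> 15 + 6"
  proof (rule add_mono)
    show "card (f ` P \<union> (\<lambda>z. f (- z)) ` M) \<le> 15"
      using P_sub M_sub card_mono[OF finite_canonical_coords, of "f ` P \<union> (\<lambda>z. f (- z)) ` M" \<tau>]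
        card_canonical_coords[of \<tau>] by simp
    have "card special_coords = 6" by (simp add: special_coords_def)
    then show "card (f ` P \<inter> (\<lambda>z. f (- z)) ` M) \<le> 6"
      using card_mono[OF _ both] by (simp add: special_coords_def)
  qed
  finally show ?thesis by simp
qed

end

theorem theorem9:
  fixes K :: "complex set" and m :: nat
  assumes "imaginary_quadratic_field K"
    and "m \<ge> 43"
  shows "\<not> (\<exists>A. diophantine_tuple (ring_of_integers K) m A \<and> 0 \<notin> A)"
proof
  assume "\<exists>A. diophantine_tuple (ring_of_integers K) m A \<and> 0 \<notin> A"
  then obtain A where A: "A \<subseteq> ring_of_integers K" "finite A" "card A = m" "0 \<notin> A"
    and sq: "\<And>a b. a \<in> A \<Longrightarrow> b \<in> A \<Longrightarrow> a \<noteq> b \<Longrightarrow> \<exists>c\<in>ring_of_integers K. a * b + 1 = c ^ 2"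
    unfolding diophantine_tuple_def by blast
  interpret imaginary_quadratic K by unfold_locales fact
  \<comment> \<open>The split at 3 is where the gap inequality for triples becomes available; the
    two counts add up to 41.\<close>
  have "card {a \<in> A. norm a < 3} \<le> 21"
    using A sq by (intro card_small_elements) auto
  moreover have "card {a \<in> A. 3 \<le> norm a} \<le> 20"
    using A sq by (intro card_large_elements) auto
  moreover have "card A = card {a \<in> A. norm a < 3} + card {a \<in> A. 3 \<le> norm a}"
    using A(2) by (subst card_Un_disjoint[symmetric]) (auto intro: arg_cong[of _ _ card])
  ultimately show False using A(3) assms(2) by linarith
qed

end
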